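(* Let $G$ be an infinite compact abelian group with dual group $\varGamma$ and let $\varLambda \subset \varGamma$. If $L^1_\varLambda(G)$ is a rich subspace of $L^1(G)$, then $C_\varLambda(G)$ is a rich subspace of $C(G)$.
   Context: $\varGamma$ is the (discrete) group of continuous homomorphisms $G \to \mathbb T$; $m$ is the normalized Haar measure on $G$; $L^1(G) = L^1(G,m)$ and $C(G)$ (sup norm) consist of complex-valued functions. $\hat f(\gamma) = \int_G f\overline\gamma\,dm$. $C_\varLambda(G)$ (resp. $L^1_\varLambda(G)$) is the set of $f$ in $C(G)$ (resp. $L^1(G)$) with $\hat f(\gamma) = 0$ for all $\gamma \in \varGamma\setminus\varLambda$. A Banach space $X$ has the Daugavet property if every bounded rank-one operator $T: X \to X$ satisfies $\|\mathrm{Id}+T\| = 1 + \|T\|$. ($C(G)$ and $L^1(G)$ have the Daugavet property.) If $X$ has the Daugavet property and $E$ is a Banach space, a bounded linear operator $T: X\to E$ is narrow if for all $x,y \in S_X$ (unit sphere), $x^*\in X^*$, $\varepsilon>0$ there is $z \in S_X$ with $\|T(y-z)\| + |x^*(y-z)| \le \varepsilon$ and $\|x+z\| \ge 2-\varepsilon$. A closed subspace $Y$ of $X$ is rich if the quotient map $X \to X/Y$ is narrow. *)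

theory Defs
  imports "HOL-Analysis.Analysis" "HOL-Probability.Probability_Measure"
    "HOL-Algebra.Module" "HOL-Algebra.AbelCoset"
begin

definition complex_field :: "complex ring" where
  "complex_field = \<lparr>carrier = UNIV, mult = (*), one = 1, zero = 0, add = (+)\<rparr>"

text \<open>
  A vector space is a module over the field of complex numbers. The fields \<open>mult\<close> and \<open>one\<close>,
  which the record type of modules inherits from rings, play no role and are left \<open>undefined\<close>.
\<close>

record 'v normed_module = "(complex, 'v) module" +
  vnorm :: "'v \<Rightarrow> real"

locale complex_normed_space = module complex_field X
  for X :: "('v, 'x) normed_module_scheme" (structure) +
  assumes vnorm_nonneg: "x \<in> carrier X \<Longrightarrow> 0 \<le> vnorm X x"
    and vnorm_eq_0: "x \<in> carrier X \<Longrightarrow> vnorm X x = 0 \<longleftrightarrow> x = \<zero>"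
    and vnorm_smult: "x \<in> carrier X \<Longrightarrow> vnorm X (c \<odot>\<^bsub>X\<^esub> x) = cmod c * vnorm X x"
    and vnorm_triangle: "x \<in> carrier X \<Longrightarrow> y \<in> carrier X \<Longrightarrow> vnorm X (x \<oplus> y) \<le> vnorm X x + vnorm X y"

text \<open>
  The locale \<^locale>\<open>Metric_space\<close> requires symmetry and non-negativity on the whole type, hence the
  value 0 off the carrier.
\<close>

definition vdist :: "('v, 'x) normed_module_scheme \<Rightarrow> 'v \<Rightarrow> 'v \<Rightarrow> real" where
  "vdist X x y = (if x \<in> carrier X \<and> y \<in> carrier X then vnorm X (x \<ominus>\<^bsub>X\<^esub> y) else 0)"

locale complex_banach_space = complex_normed_space +
  assumes complete: "Metric_space.mcomplete (carrier X) (vdist X)"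

definition closed_subspace :: "'v set \<Rightarrow> ('v, 'x) normed_module_scheme \<Rightarrow> bool" where
  "closed_subspace Y X \<longleftrightarrow>
     submodule Y complex_field X \<and> closedin (Metric_space.mtopology (carrier X) (vdist X)) Y"

definition unit_sphere :: "('v, 'x) normed_module_scheme \<Rightarrow> 'v set" where
  "unit_sphere X = {x \<in> carrier X. vnorm X x = 1}"

text \<open>Operators are functions on the whole type; only their values on the carrier matter.\<close>

definition bounded_operator ::
  "('v, 'x) normed_module_scheme \<Rightarrow> ('w, 'y) normed_module_scheme \<Rightarrow> ('v \<Rightarrow> 'w) \<Rightarrow> bool" where
  "bounded_operator X E T \<longleftrightarrow>
     T \<in> carrier X \<rightarrow> carrier E \<and>
     (\<forall>x\<in>carrier X. \<forall>y\<in>carrier X. T (x \<oplus>\<^bsub>X\<^esub> y) = T x \<oplus>\<^bsub>E\<^esub> T y) \<and>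
     (\<forall>c. \<forall>x\<in>carrier X. T (c \<odot>\<^bsub>X\<^esub> x) = c \<odot>\<^bsub>E\<^esub> T x) \<and>
     (\<exists>K. \<forall>x\<in>carrier X. vnorm E (T x) \<le> K * vnorm X x)"

definition operator_norm ::
  "('v, 'x) normed_module_scheme \<Rightarrow> ('w, 'y) normed_module_scheme \<Rightarrow> ('v \<Rightarrow> 'w) \<Rightarrow> real" where
  "operator_norm X E T = (SUP x \<in> {x \<in> carrier X. vnorm X x \<le> 1}. vnorm E (T x))"

definition complex_scalars :: "complex normed_module" where
  "complex_scalars =
     \<lparr>carrier = UNIV, mult = (*), one = 1, zero = 0, add = (+), smult = (*), vnorm = cmod\<rparr>"

definition dual_space :: "('v, 'x) normed_module_scheme \<Rightarrow> ('v \<Rightarrow> complex) set" where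
  "dual_space X = {\<phi>. bounded_operator X complex_scalars \<phi>}"

definition quotient_space :: "('v, 'x) normed_module_scheme \<Rightarrow> 'v set \<Rightarrow> 'v set normed_module" where
  "quotient_space X Y =
     \<lparr>carrier = a_rcosets\<^bsub>X\<^esub> Y, mult = undefined, one = undefined, zero = Y,
      add = (\<lambda>A B. A <+>\<^bsub>X\<^esub> B),
      smult = (\<lambda>c A. (\<lambda>a. c \<odot>\<^bsub>X\<^esub> a) ` A <+>\<^bsub>X\<^esub> Y), \<comment> \<open>adding \<open>Y\<close> matters only for \<open>c = 0\<close>\<close>
      vnorm = (\<lambda>A. INF a\<in>A. vnorm X a)\<rparr>"

definition rank_one ::
  "('v, 'x) normed_module_scheme \<Rightarrow> ('w, 'y) normed_module_scheme \<Rightarrow> ('v \<Rightarrow> 'w) \<Rightarrow> bool" where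
  "rank_one X E T \<longleftrightarrow>
     (\<exists>e\<in>carrier E. e \<noteq> \<zero>\<^bsub>E\<^esub> \<and> T ` carrier X = range (\<lambda>c. c \<odot>\<^bsub>E\<^esub> e))"

definition daugavet_property :: "('v, 'x) normed_module_scheme \<Rightarrow> bool" where
  "daugavet_property X \<longleftrightarrow>
     complex_banach_space X \<and>
     (\<forall>T. bounded_operator X X T \<longrightarrow> rank_one X X T \<longrightarrow>
        operator_norm X X (\<lambda>x. x \<oplus>\<^bsub>X\<^esub> T x) = 1 + operator_norm X X T)"

text \<open>
  Narrow operators are only defined on spaces with the Daugavet property; this proviso is part of
  the definition.
\<close>

definition narrow ::
  "('v, 'x) normed_module_scheme \<Rightarrow> ('w, 'y) normed_module_scheme \<Rightarrow> ('v \<Rightarrow> 'w) \<Rightarrow> bool" where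
  "narrow X E T \<longleftrightarrow>
     daugavet_property X \<and> complex_banach_space E \<and> bounded_operator X E T \<and>
     (\<forall>x\<in>unit_sphere X. \<forall>y\<in>unit_sphere X. \<forall>\<phi>\<in>dual_space X. \<forall>\<epsilon>>0.
        \<exists>z\<in>unit_sphere X.
          vnorm E (T (y \<ominus>\<^bsub>X\<^esub> z)) + cmod (\<phi> (y \<ominus>\<^bsub>X\<^esub> z)) \<le> \<epsilon> \<and>
          vnorm X (x \<oplus>\<^bsub>X\<^esub> z) \<ge> 2 - \<epsilon>)"

definition rich :: "('v, 'x) normed_module_scheme \<Rightarrow> 'v set \<Rightarrow> bool" where
  "rich X Y \<longleftrightarrow> closed_subspace Y X \<and> narrow X (quotient_space X Y) (\<lambda>x. Y +>\<^bsub>X\<^esub> x)"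

text \<open>
  The group is written additively and its elements exhaust a type. Regularity is part of the
  definition of Haar measure: the group need not be metrizable, so it is not automatic.
\<close>

definition normalized_haar_measure ::
  "'g::{topological_ab_group_add, t2_space} measure \<Rightarrow> bool" where
  "normalized_haar_measure m \<longleftrightarrow>
     sets m = sets borel \<and> prob_space m \<and>
     (\<forall>a. distr m borel (\<lambda>x. a + x) = m) \<and>
     (\<forall>A\<in>sets borel. emeasure m A = (INF U\<in>{U. A \<subseteq> U \<and> open U}. emeasure m U)) \<and>
     (\<forall>A\<in>sets borel. emeasure m A = (SUP K\<in>{K. K \<subseteq> A \<and> compact K}. emeasure m K))"

definition dual_group :: "('g::topological_ab_group_add \<Rightarrow> complex) set" where
  "dual_group = {\<gamma>. continuous_on UNIV \<gamma> \<and> (\<forall>x. cmod (\<gamma> x) = 1) \<and> (\<forall>x y. \<gamma> (x + y) = \<gamma> x * \<gamma> y)}"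

definition fourier :: "'g measure \<Rightarrow> ('g \<Rightarrow> complex) \<Rightarrow> ('g \<Rightarrow> complex) \<Rightarrow> complex" where
  "fourier m f \<gamma> = (LINT x|m. f x * cnj (\<gamma> x))"

text \<open>On a compact space every continuous function is bounded.\<close>

definition C_space :: "('g::topological_space \<Rightarrow>\<^sub>C complex) normed_module" where
  "C_space =
     \<lparr>carrier = UNIV, mult = undefined, one = undefined, zero = 0, add = (+),
      smult = (\<lambda>c f. Bcontfun (\<lambda>x. c * apply_bcontfun f x)), vnorm = norm\<rparr>"

definition C_spectral ::
  "'g::topological_ab_group_add measure \<Rightarrow> ('g \<Rightarrow> complex) set \<Rightarrow> ('g \<Rightarrow>\<^sub>C complex) set" where
  "C_spectral m \<Lambda> =
     {f \<in> carrier C_space. \<forall>\<gamma> \<in> dual_group - \<Lambda>. fourier m (apply_bcontfun f) \<gamma> = 0}"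

text \<open>
  \<open>L1_space m\<close> consists of the classes of integrable functions modulo equality almost everywhere:
  it is the quotient of the seminormed space of integrable functions by the null functions. (The
  seminorm is constant on each class, so the infimum in the quotient norm is its value.)
\<close>

definition integrable_functions :: "'g measure \<Rightarrow> ('g \<Rightarrow> complex) normed_module" where
  "integrable_functions m =
     \<lparr>carrier = {f. integrable m f}, mult = undefined, one = undefined,
      zero = (\<lambda>x. 0), add = (\<lambda>f g x. f x + g x), smult = (\<lambda>c f x. c * f x),
      vnorm = (\<lambda>f. LINT x|m. cmod (f x))\<rparr>"

definition null_functions :: "'g measure \<Rightarrow> ('g \<Rightarrow> complex) set" where
  "null_functions m = {f. integrable m f \<and> (AE x in m. f x = 0)}"

definition L1_space :: "'g measure \<Rightarrow> ('g \<Rightarrow> complex) set normed_module" where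
  "L1_space m = quotient_space (integrable_functions m) (null_functions m)"

definition L1_spectral ::
  "'g::topological_ab_group_add measure \<Rightarrow> ('g \<Rightarrow> complex) set \<Rightarrow> ('g \<Rightarrow> complex) set set" where
  "L1_spectral m \<Lambda> =
     {F \<in> carrier (L1_space m). \<forall>f\<in>F. \<forall>\<gamma> \<in> dual_group - \<Lambda>. fourier m f \<gamma> = 0}"

end

theory Submission
  imports Defs
begin

text \<open>
  Let \<open>W\<close> be a small open neighbourhood of \<open>0\<close> and \<open>y = 1\<^sub>W / m W\<close>. Apply the narrowness of the
  quotient map of \<open>L\<^sup>1\<close> to the unit vectors \<open>-y\<close> and \<open>y\<close> and to the functional \<open>f \<mapsto> \<integral>\<^sub>W f dm\<close>:
  it yields a unit vector \<open>z\<close> with \<open>y - z\<close> close to \<open>L\<^sup>1\<^sub>\<Lambda>\<close>. The functional forces \<open>z\<close> to be almost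
  nonnegative and carried by \<open>W\<close>; since \<open>z\<close> is almost at distance \<open>2\<close> from \<open>y\<close>, its mass sits on a set
  \<open>P\<close> whose measure is tiny compared with \<open>m W\<close>. Let \<open>u\<close> be a continuous approximation of \<open>1\<^sub>P\<close>. In
  \<open>x \<mapsto> \<integral> (z - y)(s) u(s - x) dm(s)\<close> the term from \<open>y\<close> is uniformly small and the term from \<open>z\<close>
  is close to a function with values in \<open>[0, 1]\<close>, supported in \<open>W - W\<close> and almost \<open>1\<close> at \<open>0\<close>. Hence
  \<open>C\<^sub>\<Lambda>\<close> contains, up to small uniform errors, such peaks at every point and at every scale.

  Given unit vectors \<open>x\<close>, \<open>y\<close> of \<open>C(G)\<close>, choose an open set on which both are almost constant, equal to
  \<open>\<xi>\<close> and \<open>\<eta>\<close>, with \<open>\<bar>\<xi>\<bar>\<close> almost \<open>1\<close>, and correct \<open>y\<close> to \<open>y + (\<xi> - \<eta>) q\<close> by a peak \<open>q\<close> supported there. As there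
  are arbitrarily many disjoint places for \<open>q\<close>, a given functional is small on one of these peaks. The same correction
  gives the Daugavet property of \<open>C(G)\<close>.
\<close>

section \<open>Correlation integrals on a compact group\<close>

text \<open>The tube lemma around the slice \<open>{a} \<times> UNIV\<close> yields one
  neighbourhood of \<open>a\<close> that works for all \<open>x\<close> at once. This plays the part
  of uniform continuity on a group that need not be metrizable.\<close>

lemma continuous_uniform_translates:
  fixes u :: "'g::topological_ab_group_add \<Rightarrow> complex"
  assumes "compact (UNIV :: 'g set)" and "continuous_on UNIV u" and "e > 0"
  obtains V where "open V" "a \<in> V" "\<And>x b. b \<in> V \<Longrightarrow> dist (u (b - x)) (u (a - x)) < e"
proof -
  let ?W = "{p :: 'g \<times> 'g. dist (u (fst p - snd p)) (u (a - snd p)) < e}"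
  have "continuous_on UNIV (\<lambda>p. dist (u (fst p - snd p)) (u (a - snd p)))"
    by (intro continuous_intros continuous_on_compose2[OF assms(2)]) auto
  then have "open ?W"
    by (intro open_Collect_less continuous_on_const) auto
  moreover have "{a} \<times> UNIV \<subseteq> ?W"
    using assms(3) by auto
  ultimately obtain V where V: "a \<in> V" "open V" "V \<times> UNIV \<subseteq> ?W"
    using Elementary_Topology.tube_lemma[OF assms(1), of ?W a] by blast
  have "dist (u (b - x)) (u (a - x)) < e" if "b \<in> V" for x b
    using subsetD[OF V(3), of "(b, x)"] that by simp
  then show thesis
    using V that by blast
qed

section \<open>Haar measure on a compact group: integrability, invariance, full support\<close>

locale compact_haar = prob_space m
  for m :: "'g::{topological_ab_group_add, t2_space} measure" +
  assumes compact_UNIV: "compact (UNIV :: 'g set)"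
    and haar: "normalized_haar_measure m"
begin

lemma sets_m [measurable_cong]: "sets m = sets borel"
  using haar by (simp add: normalized_haar_measure_def)

lemma space_m [simp]: "space m = UNIV"
  using sets_eq_imp_space_eq[OF sets_m] by simp

lemma borel_measurable_m: "borel_measurable m = borel_measurable borel"
  by (rule measurable_cong_sets) (auto simp: sets_m)

lemma continuous_measurable:
  fixes f :: "'g \<Rightarrow> 'b::topological_space"
  shows "continuous_on UNIV f \<Longrightarrow> f \<in> borel_measurable m"
  by (metis borel_measurable_continuous_onI borel_measurable_m)

lemma continuous_bounded:
  fixes f :: "'g \<Rightarrow> 'b::real_normed_vector"
  assumes "continuous_on UNIV f"
  obtains B where "0 < B" "\<And>x. norm (f x) \<le> B"
  using compact_imp_bounded[OF compact_continuous_image[OF assms compact_UNIV]]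
  by (auto simp: bounded_pos)

lemma continuous_integrable:
  fixes f :: "'g \<Rightarrow> complex"
  assumes "continuous_on UNIV f"
  shows "integrable m f"
  using continuous_bounded[OF assms] continuous_measurable[OF assms]
  by (metis integrable_const_bound AE_I2)

lemma integrable_mult_continuous:
  fixes f u :: "'g \<Rightarrow> complex"
  assumes "integrable m f" "continuous_on UNIV u"
  shows "integrable m (\<lambda>x. f x * u x)"
proof -
  obtain B where B: "0 < B" "\<And>x. norm (u x) \<le> B"
    using continuous_bounded[OF assms(2)] by blast
  have [measurable]: "u \<in> borel_measurable m" "f \<in> borel_measurable m"
    using assms continuous_measurable by auto
  show ?thesis
    by (rule Bochner_Integration.integrable_bound[of _ "\<lambda>x. norm (f x) * B"])
      (use assms(1) B in \<open>auto simp: norm_mult abs_mult intro!: AE_I2 mult_left_mono\<close>)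
qed

lemma translate_measurable [measurable]: "(\<lambda>x. a + x) \<in> measurable m m"
proof -
  have "(\<lambda>x :: 'g. a + x) \<in> measurable borel borel"
    by (intro borel_measurable_continuous_onI continuous_intros)
  then show ?thesis
    by (simp add: measurable_cong_sets[OF sets_m sets_m])
qed

lemma distr_translate: "distr m m (\<lambda>x. a + x) = m"
proof -
  have "distr m m (\<lambda>x. a + x) = distr m borel (\<lambda>x. a + x)"
    by (rule distr_cong) (auto simp: sets_m)
  then show ?thesis
    using haar by (simp add: normalized_haar_measure_def)
qed

lemma integral_translate:
  fixes f :: "'g \<Rightarrow> 'b::{banach, second_countable_topology}"
  assumes "f \<in> borel_measurable m"
  shows "(LINT x|m. f (a + x)) = (LINT x|m. f x)"
  using integral_distr[OF translate_measurable assms, of a] by (simp add: distr_translate)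

lemma measure_translate:
  assumes "A \<in> sets m"
  shows "measure m ((\<lambda>x. a + x) -` A) = measure m A"
  using measure_distr[OF translate_measurable assms, of a] by (simp add: distr_translate)

text \<open>Finitely many translates of \<open>W\<close> cover the compact group, and all have the
  measure of \<open>W\<close>; were it 0, the whole group would be null.\<close>

lemma open_measure_pos:
  assumes "open W" "W \<noteq> {}"
  shows "0 < measure m W"
proof (rule ccontr)
  assume "\<not> 0 < measure m W"
  then have W0: "measure m W = 0"
    using measure_nonneg[of m W] by linarith
  obtain w where w: "w \<in> W"
    using assms by auto
  define T where "T = (\<lambda>a. (\<lambda>x. a + x) -` W)"
  have opT: "open (T a)" for a
    unfolding T_def by (intro open_vimage assms continuous_intros)
  have "UNIV \<subseteq> (\<Union>a. T a)"
  proof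
    fix x :: 'g
    have "x \<in> T (w - x)"
      using w by (simp add: T_def)
    then show "x \<in> (\<Union>a. T a)" by blast
  qed
  then obtain D where D: "finite D" "UNIV \<subseteq> (\<Union>a\<in>D. T a)"
    using compactE_image[OF compact_UNIV, of UNIV T] opT by metis
  have [measurable]: "T a \<in> sets m" for a
    using opT by (simp add: sets_m)
  have "measure m (T a) = 0" for a
    using measure_translate[of W a] W0 assms by (simp add: T_def sets_m)
  then have "measure m (\<Union>a\<in>D. T a) \<le> 0"
    using finite_measure_subadditive_finite[OF D(1), of T] by (simp add: image_subset_iff)
  moreover have "(\<Union>a\<in>D. T a) = space m"
    using D by auto
  ultimately show False
    using prob_space by simp
qed

text \<open>Continuity on the product does not suffice: if the group is not second countable, the
  Borel sets of the product may exceed the product sigma-algebra. Hence the kernel is approximated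
  uniformly by functions that equal \<open>u (c - x)\<close> on finitely many strips where the
  second coordinate lies in \<open>V c\<close>. Fubini's theorem later requires this
  measurability.\<close>

lemma measurable_difference_kernel:
  fixes u :: "'g \<Rightarrow> complex"
  assumes "continuous_on UNIV u"
  shows "(\<lambda>p. u (snd p - fst p)) \<in> borel_measurable (m \<Otimes>\<^sub>M m)"
proof -
  have approx: "\<exists>s\<in>borel_measurable (m \<Otimes>\<^sub>M m). \<forall>p. dist (s p) (u (snd p - fst p)) < e"
    if "e > 0" for e
  proof -
    have "\<exists>V. open V \<and> a \<in> V \<and> (\<forall>x. \<forall>b\<in>V. dist (u (b - x)) (u (a - x)) < e)" for a
      by (rule continuous_uniform_translates[OF compact_UNIV assms \<open>e > 0\<close>, of a]) (intro exI conjI allI ballI)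
    then obtain V where V: "\<And>a. open (V a)" "\<And>a. a \<in> V a"
      "\<And>a b x. b \<in> V a \<Longrightarrow> dist (u (b - x)) (u (a - x)) < e"
      by metis
    obtain D where D: "finite D" "UNIV \<subseteq> (\<Union>a\<in>D. V a)"
      using compactE_image[OF compact_UNIV, of UNIV V] V by (metis UNIV_I UN_I subsetI)
    \<comment> \<open>Induction over the finite cover; on overlaps the strip added last overrides,
      and the bound is claimed only where the cover has arrived.\<close>
    have "\<exists>s\<in>borel_measurable (m \<Otimes>\<^sub>M m).
        \<forall>p. snd p \<in> (\<Union>a\<in>D. V a) \<longrightarrow> dist (s p) (u (snd p - fst p)) < e"
      using D(1)
    proof induction
      case empty
      show ?case by (intro bexI[of _ "\<lambda>_. 0"]) simp_all
    next
      case (insert c D)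
      then obtain s where [measurable]: "s \<in> borel_measurable (m \<Otimes>\<^sub>M m)"
        and s: "\<And>p. snd p \<in> (\<Union>a\<in>D. V a) \<Longrightarrow> dist (s p) (u (snd p - fst p)) < e"
        using insert.IH by blast
      have [measurable]: "V c \<in> sets m" "(\<lambda>x. u (c - x)) \<in> borel_measurable m"
        using V(1) by (auto simp: sets_m intro!: continuous_measurable continuous_intros
            continuous_on_compose2[OF assms])
      have "(\<lambda>p. if snd p \<in> V c then u (c - fst p) else s p) \<in> borel_measurable (m \<Otimes>\<^sub>M m)"
        by measurable
      moreover have "dist (if snd p \<in> V c then u (c - fst p) else s p) (u (snd p - fst p)) < e"
        if "snd p \<in> (\<Union>a\<in>insert c D. V a)" for p
        using that s[of p] V(3)[of "snd p" c "fst p"] by (auto simp: dist_commute)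
      ultimately show ?case
        by (intro bexI[of _ "\<lambda>p. if snd p \<in> V c then u (c - fst p) else s p"] allI impI)
    qed
    then obtain s where "s \<in> borel_measurable (m \<Otimes>\<^sub>M m)"
      "\<And>p. snd p \<in> (\<Union>a\<in>D. V a) \<Longrightarrow> dist (s p) (u (snd p - fst p)) < e"
      by blast
    moreover have "y \<in> (\<Union>a\<in>D. V a)" for y
      using D(2) by blast
    ultimately show ?thesis
      by (intro bexI[of _ s]) simp_all
  qed
  have "\<forall>n. \<exists>s\<in>borel_measurable (m \<Otimes>\<^sub>M m). \<forall>p. dist (s p) (u (snd p - fst p)) < inverse (real (Suc n))"
    using approx by simp
  then obtain s where s: "\<And>n. s n \<in> borel_measurable (m \<Otimes>\<^sub>M m)"
    "\<And>n p. dist (s n p) (u (snd p - fst p)) < inverse (real (Suc n))"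
    by metis
  show ?thesis
  proof (rule borel_measurable_LIMSEQ_metric[OF s(1)])
    fix p
    have "dist (s n p) (u (snd p - fst p)) \<le> dist (inverse (real (Suc n))) 0" for n
      using s(2)[of n p] by (simp add: dist_real_def del: of_nat_Suc)
    then show "(\<lambda>n. s n p) \<longlonglongrightarrow> u (snd p - fst p)"
      by (rule metric_tendsto_imp_tendsto[OF LIMSEQ_inverse_real_of_nat always_eventually[OF allI]])
  qed
qed

section \<open>Correlations: uniform bounds, continuity, Fourier coefficients\<close>

definition correlation :: "('g \<Rightarrow> complex) \<Rightarrow> ('g \<Rightarrow> complex) \<Rightarrow> 'g \<Rightarrow> complex" where
  "correlation f u x = (LINT y|m. f y * u (y - x))"

lemma continuous_translate_neg:
  fixes u :: "'g \<Rightarrow> 'b::topological_space"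
  assumes "continuous_on UNIV u"
  shows "continuous_on UNIV (\<lambda>y. u (y - x))"
  by (intro continuous_on_compose2[OF assms] continuous_intros) auto

text \<open>Turns an L^1 error in \<open>f\<close> into a uniform error; this is how estimates in
  \<open>L1_space\<close> reach the sup norm.\<close>

lemma correlation_bound:
  assumes "integrable m f" "continuous_on UNIV u" "\<And>y. norm (u y) \<le> B"
  shows "cmod (correlation f u x) \<le> B * (LINT y|m. cmod (f y))"
proof -
  have "cmod (correlation f u x) \<le> (LINT y|m. cmod (f y * u (y - x)))"
    unfolding correlation_def by (rule integral_norm_bound)
  also have "\<dots> \<le> (LINT y|m. B * cmod (f y))"
    using assms integrable_mult_continuous[OF assms(1) continuous_translate_neg[OF assms(2)]]
    by (intro integral_mono integrable_norm integrable_mult_right)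
      (auto simp: norm_mult mult.commute[of "cmod (f _)"] intro!: mult_right_mono)
  finally show ?thesis by simp
qed

lemma correlation_diff:
  assumes "integrable m f" "integrable m g" "continuous_on UNIV u"
  shows "correlation (\<lambda>y. f y - g y) u x = correlation f u x - correlation g u x"
  unfolding correlation_def left_diff_distrib
  using integrable_mult_continuous[OF assms(1) continuous_translate_neg[OF assms(3)]]
    integrable_mult_continuous[OF assms(2) continuous_translate_neg[OF assms(3)]]
  by simp

lemma correlation_continuous:
  assumes f: "integrable m f" and u: "continuous_on UNIV u"
  shows "continuous_on UNIV (correlation f u)"
  unfolding continuous_on_topological
proof (intro ballI allI impI)
  fix a B assume "open B" "correlation f u a \<in> B"
  then obtain e where e: "e > 0" "ball (correlation f u a) e \<subseteq> B"
    using open_contains_ball by blast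
  define I where "I = (LINT y|m. cmod (f y))"
  have I: "0 \<le> I"
    unfolding I_def by (rule integral_nonneg_AE) simp
  \<comment> \<open>Passing to the reflection puts the parameter \<open>b\<close> of
    \<open>u (y - b) = u (- (b - y))\<close> in the place where
    \<open>continuous_uniform_translates\<close> expects it. Dividing \<open>e\<close> by
    \<open>I + 1\<close> instead of \<open>I\<close> covers the case of a null
    \<open>f\<close>.\<close>
  have uneg: "continuous_on UNIV (\<lambda>x. u (- x))"
    by (intro continuous_on_compose2[OF u] continuous_intros) auto
  obtain V where V: "open V" "a \<in> V"
    and d: "\<And>x b. b \<in> V \<Longrightarrow> dist (u (- (b - x))) (u (- (a - x))) < e / (I + 1)"
    using continuous_uniform_translates[OF compact_UNIV uneg, of "e / (I + 1)" a] e I by auto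
  have "correlation f u b \<in> B" if b: "b \<in> V" for b
  proof -
    have "correlation f u b - correlation f u a = (LINT y|m. f y * (u (y - b) - u (y - a)))"
      unfolding correlation_def right_diff_distrib
      using integrable_mult_continuous[OF f continuous_translate_neg[OF u]] by simp
    also have "cmod \<dots> \<le> (LINT y|m. cmod (f y * (u (y - b) - u (y - a))))"
      by (rule integral_norm_bound)
    also have "\<dots> \<le> (LINT y|m. (e / (I + 1)) * cmod (f y))"
    proof (rule integral_mono)
      show "integrable m (\<lambda>y. cmod (f y * (u (y - b) - u (y - a))))"
        by (intro integrable_norm integrable_mult_continuous f continuous_intros
            continuous_translate_neg u)
      fix y
      have "cmod (u (y - b) - u (y - a)) \<le> e / (I + 1)"
        using d[OF b, of y] by (simp add: dist_norm)
      then show "cmod (f y * (u (y - b) - u (y - a))) \<le> e / (I + 1) * cmod (f y)"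
        unfolding norm_mult by (subst mult.commute) (rule mult_right_mono, simp_all)
    qed (use f in auto)
    also have "\<dots> = e * (I / (I + 1))"
      by (simp add: I_def)
    also have "\<dots> < e * 1"
      using I e(1) by (intro mult_strict_left_mono) (auto simp: field_simps)
    finally have "dist (correlation f u a) (correlation f u b) < e"
      by (simp add: dist_norm norm_minus_commute)
    then show ?thesis
      using e(2) by auto
  qed
  then show "\<exists>A. open A \<and> a \<in> A \<and> (\<forall>y\<in>UNIV. y \<in> A \<longrightarrow> correlation f u y \<in> B)"
    using V by blast
qed

text \<open>\<open>correlation f u\<close> is the convolution of \<open>f\<close> with the
  reflection of \<open>u\<close>, so this is the convolution theorem. Its use is that a correlation
  inherits all vanishing Fourier coefficients of \<open>f\<close>, whatever \<open>u\<close>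
  is.\<close>

lemma fourier_correlation:
  assumes f: "integrable m f" and u: "continuous_on UNIV u" and \<gamma>: "\<gamma> \<in> dual_group"
  shows "fourier m (correlation f u) \<gamma> = fourier m f \<gamma> * fourier m (\<lambda>x. u (- x)) \<gamma>"
proof -
  interpret P: pair_prob_space m m ..
  have c\<gamma>: "continuous_on UNIV \<gamma>" and n\<gamma>: "\<And>x. cmod (\<gamma> x) = 1"
    and h\<gamma>: "\<And>x y. \<gamma> (x + y) = \<gamma> x * \<gamma> y"
    using \<gamma> by (auto simp: dual_group_def)
  have [measurable]: "f \<in> borel_measurable m" "(\<lambda>x. cnj (\<gamma> x)) \<in> borel_measurable m"
    using f continuous_measurable[OF continuous_on_cnj[OF c\<gamma>]] by auto
  have [measurable]: "(\<lambda>p. u (snd p - fst p)) \<in> borel_measurable (m \<Otimes>\<^sub>M m)"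
    by (rule measurable_difference_kernel[OF u])
  obtain B where B: "0 < B" "\<And>x. norm (u x) \<le> B"
    using continuous_bounded[OF u] by blast
  define F where "F = (\<lambda>x y. f y * u (y - x) * cnj (\<gamma> x))"
  have meas: "(\<lambda>p. F (fst p) (snd p)) \<in> borel_measurable (m \<Otimes>\<^sub>M m)"
    unfolding F_def by measurable
  have int: "integrable (m \<Otimes>\<^sub>M m) (\<lambda>(x, y). F x y)"
  proof (rule Bochner_Integration.integrable_bound[of _ "\<lambda>p. cmod (f (snd p)) * B"])
    have "integrable (m \<Otimes>\<^sub>M m) (\<lambda>(x, y). f y)"
      using f by (intro P.Fubini_integrable) auto
    then show "integrable (m \<Otimes>\<^sub>M m) (\<lambda>p. cmod (f (snd p)) * B)"
      by (auto simp: split_def)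
  qed (use meas B in \<open>auto simp: split_def F_def norm_mult abs_mult n\<gamma> intro!: AE_I2 mult_left_mono\<close>)
  have "fourier m (correlation f u) \<gamma> = (LINT x|m. LINT y|m. F x y)"
    by (simp add: fourier_def correlation_def F_def)
  also have "\<dots> = (LINT y|m. LINT x|m. F x y)"
    using P.Fubini_integral[OF int] by simp
  also have "\<dots> = (LINT y|m. f y * cnj (\<gamma> y) * fourier m (\<lambda>x. u (- x)) \<gamma>)"
  proof (rule Bochner_Integration.integral_cong[OF refl])
    fix y
    let ?v = "\<lambda>x. u (- x) * cnj (\<gamma> x)"
    have "continuous_on UNIV ?v"
      by (intro continuous_intros continuous_on_compose2[OF u] c\<gamma>) auto
    then have v: "?v \<in> borel_measurable m"
      by (rule continuous_measurable)
    \<comment> \<open>Since \<open>\<gamma> x = \<gamma> y * \<gamma> (- y + x)\<close>, the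
      variable \<open>x\<close> enters only through \<open>- y + x\<close>, and invariance removes
      the shift by \<open>- y\<close>.\<close>
    have "F x y = f y * cnj (\<gamma> y) * ?v (- y + x)" for x
    proof -
      have "\<gamma> x = \<gamma> y * \<gamma> (- y + x)"
        using h\<gamma>[of y "- y + x"] by simp
      then show ?thesis by (simp add: F_def)
    qed
    then have "(LINT x|m. F x y) = f y * cnj (\<gamma> y) * (LINT x|m. ?v (- y + x))"
      by (simp only: integral_mult_right_zero)
    then show "(LINT x|m. F x y) = f y * cnj (\<gamma> y) * fourier m (\<lambda>x. u (- x)) \<gamma>"
      using integral_translate[OF v, of "- y"] by (simp add: fourier_def)
  qed
  also have "\<dots> = fourier m f \<gamma> * fourier m (\<lambda>x. u (- x)) \<gamma>"
    by (simp add: fourier_def)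
  finally show ?thesis .
qed

end

section \<open>Spectral peaks\<close>

lemma Urysohn_compact_open:
  fixes K U :: "'a::t2_space set"
  assumes "compact (UNIV :: 'a set)" "compact K" "open U" "K \<subseteq> U"
  obtains u :: "'a \<Rightarrow> real" where "continuous_on UNIV u" "\<And>x. 0 \<le> u x" "\<And>x. u x \<le> 1"
    "\<And>x. x \<in> K \<Longrightarrow> u x = 1" "\<And>x. x \<notin> U \<Longrightarrow> u x = 0"
proof -
  have "Hausdorff_space (euclidean :: 'a topology)"
    unfolding Hausdorff_space_def disjnt_def by (metis hausdorff open_openin)
  then have "normal_space (euclidean :: 'a topology)"
    by (intro compact_Hausdorff_or_regular_imp_normal_space disjI1)
      (use assms(1) in \<open>simp_all add: compact_space_def\<close>)
  then obtain u where u: "continuous_map euclidean (top_of_set {0..1::real}) u"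
    "u ` (- U) \<subseteq> {0}" "u ` K \<subseteq> {1}"
    by (rule Urysohn_lemma[of _ "- U" K 0 1])
      (use assms in \<open>auto simp: compact_imp_closed disjnt_def\<close>)
  show thesis
  proof (rule that[of u])
    show "continuous_on UNIV u"
      using u(1) by (simp add: continuous_map_in_subtopology)
    have "range u \<subseteq> {0..1}"
      using continuous_map_image_subset_topspace[OF u(1)] by simp
    then have "u x \<in> {0..1}" for x
      by blast
    then show "0 \<le> u x" "u x \<le> 1" for x
      by simp_all
  qed (use u in auto)
qed

text \<open>Continuity of \<open>t + (a - b)\<close> at \<open>(0, 0)\<close>. A correlation of two
  functions carried by \<open>W\<close>, shifted by \<open>t\<close>, lives on such points and hence
  inside \<open>U\<close>.\<close>

lemma small_difference_neighbourhood:
  fixes t :: "'g::topological_ab_group_add"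
  assumes "open U" "t \<in> U"
  obtains W where "open W" "0 \<in> W" "\<And>a b. a \<in> W \<Longrightarrow> b \<in> W \<Longrightarrow> t + (a - b) \<in> U"
proof -
  have "open ((\<lambda>p :: 'g \<times> 'g. t + (fst p - snd p)) -` U)"
    by (intro open_vimage assms continuous_intros)
  moreover have "(0, 0) \<in> (\<lambda>p :: 'g \<times> 'g. t + (fst p - snd p)) -` U"
    using assms by simp
  ultimately obtain A B where AB: "open A" "open B" "(0, 0) \<in> A \<times> B"
    "A \<times> B \<subseteq> (\<lambda>p. t + (fst p - snd p)) -` U"
    by (rule open_prod_elim)
  show thesis
    by (rule that[of "A \<inter> B"]) (use AB in auto)
qed

text \<open>For \<open>a = Re z\<close>, \<open>b = \<bar>z\<bar>\<close> one has \<open>\<bar>z - b\<bar>\<^sup>2 = 2 b (b - a)\<close>, and AM-GM applies.\<close>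

lemma cmod_diff_cmod_le:
  assumes "0 < d"
  shows "cmod (z - of_real (cmod z)) \<le> d * cmod z + (cmod z - Re z) / d"
proof (rule power2_le_imp_le)
  define b c where "b = cmod z" and "c = cmod z - Re z"
  have bc: "0 \<le> b" "0 \<le> c"
    using complex_Re_le_cmod[of z] by (auto simp: b_def c_def)
  have "(cmod (z - of_real (cmod z)))\<^sup>2 = 2 * b * c"
    using cmod_power2[of z] cmod_power2[of "z - of_real (cmod z)"]
    by (simp add: b_def c_def power2_eq_square algebra_simps)
  also have "\<dots> \<le> 4 * ((d * b) * (c / d))"
    using assms bc by simp
  also have "4 * (r * s) \<le> (r + s)\<^sup>2" for r s :: real
    using zero_le_power2[of "r - s"] by (simp add: power2_eq_square algebra_simps)
  finally show "(cmod (z - of_real (cmod z)))\<^sup>2 \<le> (d * cmod z + (cmod z - Re z) / d)\<^sup>2"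
    by (simp add: b_def c_def)
  show "0 \<le> d * cmod z + (cmod z - Re z) / d"
    using assms complex_Re_le_cmod[of z] by simp
qed

text \<open>By \<open>on_W\<close>, almost the whole norm of \<open>z\<close> is the integral of its
  real part over \<open>W\<close>, so \<open>z\<close> is close to the nonnegative function
  \<open>p\<close>. By \<open>far\<close>, the functions \<open>p\<close> and \<open>y\<close>
  hardly overlap. On \<open>P\<close> the overlap \<open>min p y\<close> equals \<open>y\<close>,
  off \<open>P\<close> it equals \<open>p\<close>: the first makes \<open>P\<close> small relative
  to \<open>W\<close>, the second leaves almost all of \<open>p\<close> on \<open>P\<close>.\<close>

lemma (in prob_space) L1_concentration:
  fixes z :: "'a \<Rightarrow> complex" and W d
  defines "y \<equiv> \<lambda>x. indicator W x / measure M W :: real"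
  defines "p \<equiv> \<lambda>x. cmod (z x) * indicator W x :: real"
  defines "P \<equiv> {x \<in> space M. x \<in> W \<and> 1 / measure M W < cmod (z x)}"
  assumes z: "integrable M z" "(LINT x|M. cmod (z x)) = 1"
    and W [measurable]: "W \<in> sets M" and pos: "0 < measure M W"
    and d: "0 < d" "d \<le> 1"
    and on_W: "cmod (LINT x|M. (of_real (y x) - z x) * indicator W x) \<le> d\<^sup>2"
    and far: "2 - d\<^sup>2 \<le> (LINT x|M. cmod (z x - of_real (y x)))"
  shows "(LINT x|M. cmod (z x - of_real (p x))) \<le> 2 * d"
    and "measure M P \<le> 2 * d * measure M W"
    and "1 - 4 * d \<le> (LINT x|M. p x * indicator P x)"
proof -
  have [measurable]: "z \<in> borel_measurable M"
    using z by auto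
  have [measurable]: "P \<in> sets M"
    unfolding P_def by measurable
  have iW: "integrable M (\<lambda>x. indicator W x :: real)"
    by (intro integrable_real_indicator) (auto simp: emeasure_eq_measure)
  have iy: "integrable M y"
    unfolding y_def using iW by simp
  have ip: "integrable M p"
    unfolding p_def using z by (intro integrable_real_mult_indicator integrable_norm) auto
  have izW: "integrable M (\<lambda>x. z x * indicator W x)"
    using integrable_mult_indicator[OF W z(1)] by (simp add: scaleR_conv_of_real mult.commute of_real_indicator)
  have y1: "(LINT x|M. y x) = 1"
    using pos by (simp add: y_def)
  have iyW: "integrable M (\<lambda>x. complex_of_real (y x))"
    using iy by simp
  have "(LINT x|M. (of_real (y x) - z x) * indicator W x)
      = (LINT x|M. complex_of_real (y x) - z x * indicator W x)"
    by (intro Bochner_Integration.integral_cong) (auto simp: y_def indicator_def)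
  also have "\<dots> = 1 - (LINT x|M. z x * indicator W x)"
    using iyW izW y1 by simp
  finally have "Re (1 - (LINT x|M. z x * indicator W x)) \<le> d\<^sup>2"
    using on_W order_trans[OF complex_Re_le_cmod] by (simp only:)
  moreover have "Re (LINT x|M. z x * indicator W x) = (LINT x|M. Re (z x) * indicator W x)"
    using izW by (subst integral_Re[symmetric]) (auto intro!: Bochner_Integration.integral_cong simp: indicator_def)
  ultimately have ReW: "1 - d\<^sup>2 \<le> (LINT x|M. Re (z x) * indicator W x)"
    by simp
  have iRe: "integrable M (\<lambda>x. Re (z x) * indicator W x)"
    using z by (intro integrable_real_mult_indicator) auto
  have izp: "integrable M (\<lambda>x. cmod (z x - of_real (p x)))"
    using z ip by (intro integrable_norm) auto
  \<comment> \<open>On \<open>W\<close> this is \<open>cmod_diff_cmod_le\<close>; off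
    \<open>W\<close>, where \<open>p\<close> vanishes,
    \<open>cmod (z x) \<le> cmod (z x) / d\<close> suffices. The deficit \<open>d\<^sup>2\<close> is
    divided by \<open>d\<close>, which is why the hypotheses carry a square.\<close>
  have "(LINT x|M. cmod (z x - of_real (p x)))
      \<le> (LINT x|M. d * cmod (z x) + (cmod (z x) - Re (z x) * indicator W x) / d)"
  proof (rule integral_mono[OF izp])
    fix x
    have "cmod (z x) \<le> cmod (z x) / d"
      using d mult_left_mono[of d 1 "cmod (z x)"] by (simp add: field_simps)
    then have "cmod (z x) \<le> d * cmod (z x) + cmod (z x) / d"
      using d by (simp add: add_increasing)
    then show "cmod (z x - of_real (p x)) \<le> d * cmod (z x) + (cmod (z x) - Re (z x) * indicator W x) / d"
      using cmod_diff_cmod_le[OF d(1), of "z x"] by (cases "x \<in> W") (auto simp: p_def)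
  qed (use z iRe in auto)
  also have "\<dots> = d + (1 - (LINT x|M. Re (z x) * indicator W x)) / d"
    using z iRe by simp
  also have "\<dots> \<le> d + d\<^sup>2 / d"
    using ReW d by (intro add_left_mono divide_right_mono) auto
  finally show zp: "(LINT x|M. cmod (z x - of_real (p x))) \<le> 2 * d"
    using d by (simp add: power2_eq_square)
  define h where "h = (\<lambda>x. min (p x) (y x))"
  have ih: "integrable M h"
    unfolding h_def using ip iy by auto
  have p1: "(LINT x|M. p x) \<le> 1"
    unfolding z(2)[symmetric] using ip z by (intro integral_mono) (auto simp: p_def indicator_def)
  have "1 \<le> (LINT x|M. cmod (z x - of_real (p x)) + p x)"
    unfolding z(2)[symmetric]
  proof (rule integral_mono)
    fix x
    show "cmod (z x) \<le> cmod (z x - of_real (p x)) + p x"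
      using norm_triangle_ineq[of "z x - of_real (p x)" "of_real (p x)"]
      by (simp add: p_def norm_mult indicator_def)
  qed (use z izp ip in auto)
  then have p2: "1 - 2 * d \<le> (LINT x|M. p x)"
    using zp izp ip by simp
  \<comment> \<open>Because \<open>\<bar>p - y\<bar> = p + y - 2 * min p y\<close> and both
    integrals are at most 1, a distance near 2 leaves little room for the overlap
    \<open>h\<close>.\<close>
  have "(LINT x|M. cmod (z x - of_real (y x)))
      \<le> (LINT x|M. cmod (z x - of_real (p x)) + (p x + y x - 2 * h x))"
  proof (rule integral_mono)
    fix x
    have "cmod (z x - of_real (y x)) \<le> cmod (z x - of_real (p x)) + cmod (of_real (p x - y x))"
      using norm_triangle_ineq[of "z x - of_real (p x)" "of_real (p x - y x)"] by simp
    also have "cmod (of_real (p x - y x)) = p x + y x - 2 * h x"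
      unfolding norm_of_real h_def by (auto simp: min_def)
    finally show "cmod (z x - of_real (y x)) \<le> cmod (z x - of_real (p x)) + (p x + y x - 2 * h x)" .
  qed (use z iy izp ip ih in auto)
  also have "\<dots> = (LINT x|M. cmod (z x - of_real (p x))) + ((LINT x|M. p x) + 1 - 2 * (LINT x|M. h x))"
    using izp ip iy ih y1 by simp
  finally have "2 * (LINT x|M. h x) \<le> d\<^sup>2 + 2 * d"
    using zp p1 far by linarith
  also have "\<dots> \<le> 4 * d"
    using d mult_left_mono[of d 1 d] by (simp add: power2_eq_square)
  finally have h: "(LINT x|M. h x) \<le> 2 * d"
    by simp
  have iP: "integrable M (\<lambda>x. indicator P x :: real)"
    by (intro integrable_real_indicator) (auto simp: emeasure_eq_measure)
  have "measure M P / measure M W = (LINT x|M. indicator P x / measure M W)"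
    by simp
  also have "\<dots> \<le> (LINT x|M. h x)"
    using iP ih pos
    by (intro integral_mono) (auto simp: h_def p_def y_def P_def indicator_def)
  also note h
  finally show "measure M P \<le> 2 * d * measure M W"
    using pos by (simp add: pos_divide_le_eq)
  have ipP: "integrable M (\<lambda>x. p x * indicator P x)"
    using ip by (intro integrable_real_mult_indicator) auto
  have "(LINT x|M. p x) \<le> (LINT x|M. p x * indicator P x + h x)"
    using ip ipP ih
    by (intro integral_mono) (auto simp: h_def p_def y_def P_def indicator_def)
  then show "1 - 4 * d \<le> (LINT x|M. p x * indicator P x)"
    using ipP ih h p2 by simp
qed

section \<open>Regularity of Haar measure and construction of the peaks\<close>

context compact_haar
begin

lemma inner_regular_measure:
  assumes "A \<in> sets m" "0 < d"
  obtains K where "compact K" "K \<subseteq> A" "measure m A - d < measure m K"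
proof -
  have "emeasure m A = (SUP K\<in>{K. K \<subseteq> A \<and> compact K}. emeasure m K)"
    using haar assms unfolding normalized_haar_measure_def sets_m by blast
  \<comment> \<open>\<open>ennreal\<close> truncates negative numbers to 0, so strictness requires
    positive measure; for a null set the empty set serves as \<open>K\<close>.\<close>
  moreover have "ennreal (measure m A - d) < emeasure m A" if "0 < measure m A"
    using that assms(2) by (simp add: emeasure_eq_measure ennreal_less_iff ennreal_lessI)
  ultimately have ex: "\<exists>K. K \<subseteq> A \<and> compact K \<and> ennreal (measure m A - d) < emeasure m K"
    if "0 < measure m A"
    using that by (auto simp: less_SUP_iff)
  show thesis
  proof (cases "0 < measure m A")
    case True
    then obtain K where K: "K \<subseteq> A" "compact K" "ennreal (measure m A - d) < emeasure m K"
      using ex by blast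
    then have "measure m A - d < measure m K"
      by (metis emeasure_eq_measure ennreal_leI linorder_not_less)
    with K that show thesis by blast
  next
    case False
    then show thesis
      using that[of "{}"] assms(2) measure_nonneg[of m A] by simp
  qed
qed

lemma outer_regular_measure:
  assumes "A \<in> sets m" "0 < d"
  obtains U where "open U" "A \<subseteq> U" "measure m U < measure m A + d"
proof -
  have "emeasure m A = (INF U\<in>{U. A \<subseteq> U \<and> open U}. emeasure m U)"
    using haar assms unfolding normalized_haar_measure_def sets_m by blast
  moreover have "emeasure m A < ennreal (measure m A + d)"
    using assms(2) by (simp add: emeasure_eq_measure ennreal_less_iff)
  ultimately obtain U where "A \<subseteq> U" "open U" "emeasure m U < ennreal (measure m A + d)"
    by (auto simp: INF_less_iff)
  then show thesis
    by (intro that[of U]) (auto simp: emeasure_eq_measure ennreal_less_iff)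
qed

text \<open>As \<open>p\<close> may be unbounded, it is cut at a level \<open>N\<close> above which
  its integral is small, by dominated convergence. Below that level the loss is at most
  \<open>N\<close> times the measure of \<open>P - K\<close>.\<close>

lemma inner_regular_integral:
  fixes p :: "'g \<Rightarrow> real"
  assumes p: "integrable m p" "\<And>x. 0 \<le> p x" and P [measurable]: "P \<in> sets m" and d: "0 < d"
  obtains K where "compact K" "K \<subseteq> P"
    "(LINT x|m. p x * indicator P x) - d \<le> (LINT x|m. p x * indicator K x)"
proof -
  have [measurable]: "p \<in> borel_measurable m"
    using p by auto
  define T where "T = (\<lambda>(n::nat) x. p x * indicator {x \<in> space m. real n < p x} x)"
  have [measurable]: "T n \<in> borel_measurable m" for n
    unfolding T_def by measurable
  have iT: "integrable m (T n)" for n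
    unfolding T_def using p by (intro integrable_real_mult_indicator) auto
  have "(\<lambda>n. LINT x|m. T n x) \<longlonglongrightarrow> (LINT x|m. 0)"
  proof (rule integral_dominated_convergence[where w = p])
    show "AE x in m. (\<lambda>n. T n x) \<longlonglongrightarrow> 0"
    proof (rule AE_I2)
      fix x
      obtain N :: nat where "p x < N"
        using reals_Archimedean2 by blast
      then have "T n x = 0" if "N \<le> n" for n
        using that by (auto simp: T_def indicator_def)
      then show "(\<lambda>n. T n x) \<longlonglongrightarrow> 0"
        by (intro tendsto_eventually eventually_sequentiallyI)
    qed
    show "AE x in m. norm (T n x) \<le> p x" for n
      using p(2) by (auto simp: T_def indicator_def)
  qed (use p in auto)
  then have "\<forall>\<^sub>F n in sequentially. (LINT x|m. T n x) < d / 2"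
    using d by (intro order_tendstoD) auto
  then obtain N where N: "(LINT x|m. T N x) < d / 2"
    by (auto simp: eventually_sequentially)
  \<comment> \<open>With this margin, values at most \<open>N\<close> on \<open>P - K\<close>
    contribute at most \<open>d / 2\<close>; the summand 1 covers \<open>N = 0\<close>.\<close>
  have "0 < d / (2 * (real N + 1))"
    using d by simp
  then obtain K where K: "compact K" "K \<subseteq> P" "measure m P - d / (2 * (real N + 1)) < measure m K"
    by (rule inner_regular_measure[OF P])
  have [measurable]: "K \<in> sets m"
    using K by (simp add: sets_m compact_imp_closed)
  have iK: "integrable m (\<lambda>x. p x * indicator K x)" "integrable m (\<lambda>x. p x * indicator P x)"
    using p by (auto intro!: integrable_real_mult_indicator)
  have iPK: "integrable m (\<lambda>x. real N * indicator (P - K) x)"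
    by (intro integrable_mult_right integrable_real_indicator) (auto simp: emeasure_eq_measure)
  have "(LINT x|m. p x * indicator P x)
      \<le> (LINT x|m. p x * indicator K x + (T N x + real N * indicator (P - K) x))"
  proof (rule integral_mono)
    fix x
    show "p x * indicator P x \<le> p x * indicator K x + (T N x + real N * indicator (P - K) x)"
      using p(2)[of x] K(2) by (auto simp: T_def indicator_def)
  qed (use iK iT iPK in auto)
  also have "\<dots> = (LINT x|m. p x * indicator K x) + ((LINT x|m. T N x) + real N * measure m (P - K))"
    using iK iT iPK by simp
  also have "real N * measure m (P - K) \<le> d / 2"
  proof -
    have "measure m (P - K) \<le> d / (2 * (real N + 1))"
      using K finite_measure_Diff[OF P, of K] by simp
    then have "real N * measure m (P - K) \<le> (real N + 1) * (d / (2 * (real N + 1)))"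
      using d by (intro mult_mono) auto
    also have "\<dots> = d / 2"
      by (simp add: field_simps)
    finally show ?thesis .
  qed
  finally show thesis
    using N K that by auto
qed

text \<open>The hypothesis \<open>narrow\<close> expresses richness in L^1 through functions instead
  of classes. The peak \<open>q\<close> is the correlation of the nonnegative part \<open>p\<close>
  of \<open>z\<close> with a translated Urysohn function, and \<open>g\<close> is the same
  correlation for \<open>- w\<close>.\<close>

lemma spectral_peak:
  fixes \<Lambda> :: "('g \<Rightarrow> complex) set"
  assumes narrow: "\<And>W e. open W \<Longrightarrow> W \<noteq> {} \<Longrightarrow> 0 < e \<Longrightarrow>
      \<exists>z w. integrable m z \<and> integrable m w \<and> (\<forall>\<gamma>\<in>dual_group - \<Lambda>. fourier m w \<gamma> = 0) \<and>
        (LINT x|m. cmod (z x)) = 1 \<and>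
        (LINT x|m. cmod (of_real (indicator W x / measure m W) - z x - w x)) \<le> e \<and>
        cmod (LINT x|m. (of_real (indicator W x / measure m W) - z x) * indicator W x) \<le> e \<and>
        2 - e \<le> (LINT x|m. cmod (z x - of_real (indicator W x / measure m W)))"
    and U: "open U" "t \<in> U" and e: "0 < e"
  obtains q :: "'g \<Rightarrow> real" and g :: "'g \<Rightarrow> complex" where
    "continuous_on UNIV q" "\<And>x. 0 \<le> q x" "\<And>x. q x \<le> 1" "\<And>x. x \<notin> U \<Longrightarrow> q x = 0" "1 - e \<le> q t"
    "continuous_on UNIV g" "\<And>\<gamma>. \<gamma> \<in> dual_group - \<Lambda> \<Longrightarrow> fourier m g \<gamma> = 0"
    "\<And>x. cmod (of_real (q x) - g x) \<le> e"
proof -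
  \<comment> \<open>Six units of error: 2 for replacing \<open>z\<close> by \<open>p\<close>, 1 for
    the distance of \<open>y - z\<close> from \<open>w\<close>, 3 for the correlation of
    \<open>y\<close>. The value at \<open>t\<close> loses only 5.\<close>
  define d where "d = min 1 (e / 6)"
  have d: "0 < d" "d \<le> 1" "6 * d \<le> e"
    using e by (auto simp: d_def)
  have dd: "d\<^sup>2 \<le> d"
    using d mult_left_mono[of d 1 d] by (simp add: power2_eq_square)
  obtain W where W: "open W" "0 \<in> W" "\<And>a b. a \<in> W \<Longrightarrow> b \<in> W \<Longrightarrow> t + (a - b) \<in> U"
    using small_difference_neighbourhood[OF U] by metis
  have [measurable]: "W \<in> sets m"
    using W by (simp add: sets_m)
  define \<mu> where "\<mu> = measure m W"
  have \<mu>: "0 < \<mu>"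
    using open_measure_pos[of W] W by (auto simp: \<mu>_def)
  define y :: "'g \<Rightarrow> real" where "y = (\<lambda>x. indicator W x / \<mu>)"
  have iy: "integrable m y"
    unfolding y_def by (intro integrable_divide integrable_real_indicator) (auto simp: emeasure_eq_measure)
  have "W \<noteq> {}" "0 < d\<^sup>2"
    using W d by auto
  from narrow[OF W(1) this]
  have "\<exists>z w. integrable m z \<and> integrable m w \<and> (\<forall>\<gamma>\<in>dual_group - \<Lambda>. fourier m w \<gamma> = 0) \<and>
      (LINT x|m. cmod (z x)) = 1 \<and> (LINT x|m. cmod (of_real (y x) - z x - w x)) \<le> d\<^sup>2 \<and>
      cmod (LINT x|m. (of_real (y x) - z x) * indicator W x) \<le> d\<^sup>2 \<and>
      2 - d\<^sup>2 \<le> (LINT x|m. cmod (z x - of_real (y x)))"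
    unfolding y_def \<mu>_def .
  then obtain z w where zw: "integrable m z" "integrable m w"
    "\<And>\<gamma>. \<gamma> \<in> dual_group - \<Lambda> \<Longrightarrow> fourier m w \<gamma> = 0" "(LINT x|m. cmod (z x)) = 1"
    "(LINT x|m. cmod (of_real (y x) - z x - w x)) \<le> d\<^sup>2"
    "cmod (LINT x|m. (of_real (y x) - z x) * indicator W x) \<le> d\<^sup>2"
    "2 - d\<^sup>2 \<le> (LINT x|m. cmod (z x - of_real (y x)))"
    by blast
  define p where "p = (\<lambda>x. cmod (z x) * indicator W x :: real)"
  define P where "P = {x \<in> space m. x \<in> W \<and> 1 / \<mu> < cmod (z x)}"
  have [measurable]: "z \<in> borel_measurable m"
    using zw by auto
  have Pm: "P \<in> sets m"
    unfolding P_def by measurable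
  have ip: "integrable m p"
    unfolding p_def using zw by (intro integrable_real_mult_indicator integrable_norm) auto
  have p0: "0 \<le> p x" for x
    by (simp add: p_def)
  have p1: "(LINT x|m. p x) \<le> 1"
    unfolding zw(4)[symmetric] using ip zw by (intro integral_mono) (auto simp: p_def indicator_def)
  have zp: "(LINT x|m. cmod (z x - of_real (p x))) \<le> 2 * d"
    and mP: "measure m P \<le> 2 * d * \<mu>"
    and pP: "1 - 4 * d \<le> (LINT x|m. p x * indicator P x)"
    unfolding p_def P_def \<mu>_def
    using L1_concentration[OF zw(1) zw(4) \<open>W \<in> sets m\<close> \<mu>[unfolded \<mu>_def] d(1,2)] zw(6,7)
    by (auto simp: y_def \<mu>_def)
  obtain K where K: "compact K" "K \<subseteq> P"
    "(LINT x|m. p x * indicator P x) - d \<le> (LINT x|m. p x * indicator K x)"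
    by (rule inner_regular_integral[OF ip p0 Pm d(1)])
  have Km [measurable]: "K \<in> sets m"
    using K by (simp add: sets_m compact_imp_closed)
  have "0 < d * \<mu>"
    using d \<mu> by simp
  then obtain V where V: "open V" "K \<subseteq> V" "measure m V < measure m K + d * \<mu>"
    by (rule outer_regular_measure[OF Km])
  have "measure m K \<le> measure m P"
    using K Pm by (intro finite_measure_mono)
  then have mV: "measure m V \<le> 3 * d * \<mu>"
    using V mP by (simp add: algebra_simps)
  have "K \<subseteq> V \<inter> W"
    using K V by (auto simp: P_def)
  \<comment> \<open>Support in \<open>V\<close> keeps the integral of \<open>u\<close> small, which
    controls the term of \<open>y\<close>; support in \<open>W\<close> places the support of
    \<open>q\<close> in \<open>U\<close>; the value 1 on \<open>K\<close> makes \<open>q t\<close>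
    large.\<close>
  then obtain u :: "'g \<Rightarrow> real" where u: "continuous_on UNIV u" "\<And>x. 0 \<le> u x" "\<And>x. u x \<le> 1"
    "\<And>x. x \<in> K \<Longrightarrow> u x = 1" "\<And>x. x \<notin> V \<inter> W \<Longrightarrow> u x = 0"
    by (rule Urysohn_compact_open[OF compact_UNIV K(1) open_Int[OF V(1) W(1)]]) (rule that, blast+)
  \<comment> \<open>The shift moves the peak from 0 to \<open>t\<close>: at \<open>x = t\<close> the
    kernel becomes \<open>u y\<close>.\<close>
  define v where "v = (\<lambda>y. complex_of_real (u (y + t)))"
  have v: "continuous_on UNIV v"
    unfolding v_def by (intro continuous_intros continuous_on_compose2[OF u(1)]) auto
  have v1: "norm (v y) \<le> 1" for y
    using u by (simp add: v_def)
  define q where "q = (\<lambda>x. LINT y|m. p y * u (y - x + t))"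
  have qc: "complex_of_real (q x) = correlation (\<lambda>y. of_real (p y)) v x" for x
    unfolding q_def correlation_def v_def by (simp flip: of_real_mult)
  have ipc: "integrable m (\<lambda>y. complex_of_real (p y))"
    using ip by simp
  have iu: "continuous_on UNIV (\<lambda>y. u (y - x + t))" for x
    by (intro continuous_intros continuous_on_compose2[OF u(1)]) auto
  have ipu: "integrable m (\<lambda>y. p y * u (y - x + t))" for x
    by (rule Bochner_Integration.integrable_bound[OF ip])
      (use ip u p0 continuous_measurable[OF iu[of x]] in
        \<open>auto simp: abs_mult intro!: AE_I2 mult_right_le_one_le borel_measurable_times\<close>)
  have q_cont: "continuous_on UNIV q"
  proof -
    have "continuous_on UNIV (\<lambda>x. Re (correlation (\<lambda>y. of_real (p y)) v x))"
      by (intro continuous_intros correlation_continuous ipc v)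
    then show ?thesis
      by (simp flip: qc)
  qed
  have q0: "0 \<le> q x" for x
    unfolding q_def using p0 u by (intro integral_nonneg_AE AE_I2 mult_nonneg_nonneg)
  have q1: "q x \<le> 1" for x
  proof -
    have "q x \<le> (LINT y|m. p y)"
      unfolding q_def using ip ipu u p0
      by (intro integral_mono mult_right_le_one_le) auto
    then show ?thesis using p1 by linarith
  qed
  have q_supp: "q x = 0" if "x \<notin> U" for x
  proof -
    have "p y * u (y - x + t) = 0" for y
    proof (rule ccontr)
      assume "p y * u (y - x + t) \<noteq> 0"
      then have "y \<in> W" "y - x + t \<in> W"
        using u(5) by (auto simp: p_def indicator_def split: if_splits)
      from W(3)[OF this] that show False by simp
    qed
    then show ?thesis by (simp only: q_def Bochner_Integration.integral_zero)
  qed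
  have q_t: "1 - e \<le> q t"
  proof -
    \<comment> \<open>The mass of \<open>p\<close> on \<open>K\<close> is at least
      \<open>1 - 5 * d\<close>: concentration costs \<open>4 * d\<close> and inner regularity
      \<open>d\<close>.\<close>
    have "(LINT y|m. p y * indicator K y) \<le> (LINT y|m. p y * u (y - t + t))"
    proof (rule integral_mono)
      show "integrable m (\<lambda>y. p y * indicator K y)"
        using ip by (auto intro!: integrable_real_mult_indicator)
      show "p y * indicator K y \<le> p y * u (y - t + t)" for y
        using p0[of y] u(2)[of y] u(4)[of y] by (auto simp: indicator_def)
    qed (rule ipu)
    then show ?thesis
      using K(3) pP d by (simp add: q_def)
  qed
  \<comment> \<open>The sign reflects that \<open>w\<close> approximates \<open>y - z\<close>,
    whereas the peak comes from \<open>z - y\<close>.\<close>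
  define g where "g = (\<lambda>x. - correlation w v x)"
  have g_cont: "continuous_on UNIV g"
    unfolding g_def by (intro continuous_intros correlation_continuous zw v)
  have g_spec: "fourier m g \<gamma> = 0" if "\<gamma> \<in> dual_group - \<Lambda>" for \<gamma>
    using fourier_correlation[OF zw(2) v, of \<gamma>] zw(3)[OF that] that
    by (simp add: g_def fourier_def)
  have close: "cmod (of_real (q x) - g x) \<le> e" for x
  proof -
    define f1 where "f1 = (\<lambda>x. z x - of_real (p x))"
    define f2 where "f2 = (\<lambda>x. of_real (y x) - z x - w x)"
    define f3 where "f3 = (\<lambda>x. complex_of_real (y x))"
    have i: "integrable m f1" "integrable m f2" "integrable m f3"
      unfolding f1_def f2_def f3_def using zw ip iy by auto
    have "correlation w v x = correlation (\<lambda>y. f3 y - f2 y - f1 y - of_real (p y)) v x"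
      by (simp add: f1_def f2_def f3_def)
    then have "of_real (q x) - g x = correlation f3 v x - correlation f2 v x - correlation f1 v x"
      using i ipc by (simp add: g_def qc correlation_diff v)
    then have "cmod (of_real (q x) - g x)
        \<le> cmod (correlation f3 v x) + cmod (correlation f2 v x) + cmod (correlation f1 v x)"
      using norm_triangle_ineq4[of "correlation f3 v x - correlation f2 v x" "correlation f1 v x"]
        norm_triangle_ineq4[of "correlation f3 v x" "correlation f2 v x"] by simp
    moreover have "cmod (correlation f1 v x) \<le> 2 * d"
      using correlation_bound[OF i(1) v v1, of x] zp by (simp add: f1_def)
    moreover have "cmod (correlation f2 v x) \<le> d"
      using correlation_bound[OF i(2) v v1, of x] zw(5) dd by (simp add: f2_def)
    \<comment> \<open>The density \<open>y\<close> is at most \<open>1 / \<mu>\<close>, and the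
      translated \<open>u\<close> has integral at most the measure of \<open>V\<close>, hence at
      most \<open>3 * d * \<mu>\<close>; the factor \<open>\<mu>\<close> cancels.\<close>
    moreover have "cmod (correlation f3 v x) \<le> 3 * d"
    proof -
      let ?k = "\<lambda>y. u (y - x + t)"
      have k: "?k = (\<lambda>y. u ((- x + t) + y))"
        by (simp add: algebra_simps)
      have um: "u \<in> borel_measurable m"
        by (rule continuous_measurable[OF u(1)])
      have ku: "(LINT s|m. ?k s) = (LINT s|m. u s)"
        unfolding k by (rule integral_translate[OF um])
      have ik: "integrable m ?k"
        using continuous_measurable[OF iu[of x]] u
        by (intro integrable_const_bound[of _ 1]) auto
      have iyk: "integrable m (\<lambda>s. y s * ?k s)"
        by (rule Bochner_Integration.integrable_bound[OF iy])
          (use iy ik u \<mu> in \<open>auto simp: abs_mult y_def indicator_def intro!: AE_I2 divide_right_mono borel_measurable_times\<close>)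
      have "correlation f3 v x = of_real (LINT s|m. y s * ?k s)"
        unfolding correlation_def f3_def v_def by (simp flip: of_real_mult)
      then have "cmod (correlation f3 v x) = \<bar>LINT s|m. y s * ?k s\<bar>"
        by simp
      also have "\<dots> = (LINT s|m. y s * ?k s)"
        using u \<mu> by (intro abs_of_nonneg integral_nonneg_AE AE_I2) (auto simp: y_def)
      also have "\<dots> \<le> (LINT s|m. (1 / \<mu>) * ?k s)"
        using iyk ik u \<mu> by (intro integral_mono mult_right_mono) (auto simp: y_def indicator_def)
      also have "\<dots> = (1 / \<mu>) * (LINT s|m. u s)"
        using ku by simp
      also have "(LINT s|m. u s) \<le> (LINT s|m. indicator V s)"
      proof (rule integral_mono)
        show "integrable m u"
          using um u by (intro integrable_const_bound[of _ 1]) auto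
        show "integrable m (\<lambda>s. indicator V s :: real)"
          using V by (intro integrable_real_indicator) (auto simp: sets_m emeasure_eq_measure)
        show "u s \<le> indicator V s" for s
          using u(3)[of s] u(5)[of s] by (auto simp: indicator_def)
      qed
      also have "\<dots> \<le> 3 * d * \<mu>"
        using mV by simp
      also have "1 / \<mu> * (3 * d * \<mu>) = 3 * d"
        using \<mu> by simp
      finally show ?thesis
        using \<mu> by (simp add: divide_right_mono)
    qed
    ultimately show ?thesis
      using d by linarith
  qed
  show thesis
    by (rule that[OF q_cont q0 q1 q_supp q_t g_cont g_spec close])
qed

end

section \<open>Integrable functions modulo null functions\<close>

text \<open>For integrable \<open>f\<close> this is the coset of \<open>f\<close> in
  \<open>L1_space m\<close>, in a form that lets all operations of that space be computed on
  representatives.\<close>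

definition L1_class :: "'a measure \<Rightarrow> ('a \<Rightarrow> complex) \<Rightarrow> ('a \<Rightarrow> complex) set" where
  "L1_class m f = {g. integrable m g \<and> (AE x in m. g x = f x)}"

lemma L1_class_self: "integrable m f \<Longrightarrow> f \<in> L1_class m f"
  by (simp add: L1_class_def)

lemma null_functions_coset:
  assumes "integrable m f"
  shows "null_functions m +>\<^bsub>integrable_functions m\<^esub> f = L1_class m f"
proof (intro equalityI subsetI)
  fix g assume "g \<in> null_functions m +>\<^bsub>integrable_functions m\<^esub> f"
  then obtain h where "integrable m h" "AE x in m. h x = 0" "g = (\<lambda>x. h x + f x)"
    by (auto simp: a_r_coset_def' null_functions_def integrable_functions_def)
  then show "g \<in> L1_class m f"
    using assms by (auto simp: L1_class_def)
next
  fix g assume g: "g \<in> L1_class m f"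
  have "(\<lambda>x. g x - f x) \<in> null_functions m"
    using g assms by (auto simp: L1_class_def null_functions_def)
  then show "g \<in> null_functions m +>\<^bsub>integrable_functions m\<^esub> f"
    by (auto simp: a_r_coset_def' integrable_functions_def intro!: bexI[of _ "\<lambda>x. g x - f x"])
qed

lemma carrier_L1_space: "carrier (L1_space m) = L1_class m ` {f. integrable m f}"
proof -
  have "carrier (L1_space m)
      = (\<lambda>f. null_functions m +>\<^bsub>integrable_functions m\<^esub> f) ` {f. integrable m f}"
    by (auto simp: L1_space_def quotient_space_def A_RCOSETS_def' integrable_functions_def)
  also have "\<dots> = L1_class m ` {f. integrable m f}"
    by (intro image_cong refl null_functions_coset) simp
  finally show ?thesis .
qed

lemma add_L1_class:
  assumes "integrable m f" "integrable m g"
  shows "L1_class m f \<oplus>\<^bsub>L1_space m\<^esub> L1_class m g = L1_class m (\<lambda>x. f x + g x)"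
proof -
  have "L1_class m f <+>\<^bsub>integrable_functions m\<^esub> L1_class m g = L1_class m (\<lambda>x. f x + g x)"
  proof (intro equalityI subsetI)
    fix k assume "k \<in> L1_class m f <+>\<^bsub>integrable_functions m\<^esub> L1_class m g"
    then show "k \<in> L1_class m (\<lambda>x. f x + g x)"
      by (auto simp: set_add_def' L1_class_def integrable_functions_def)
  next
    fix k assume k: "k \<in> L1_class m (\<lambda>x. f x + g x)"
    then have "(\<lambda>x. k x - g x) \<in> L1_class m f"
      using assms by (auto simp: L1_class_def)
    then show "k \<in> L1_class m f <+>\<^bsub>integrable_functions m\<^esub> L1_class m g"
      using L1_class_self[OF assms(2)]
      unfolding set_add_def' UN_iff
      by (intro bexI[of _ "\<lambda>x. k x - g x"] bexI[of _ g]) (auto simp: integrable_functions_def)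
  qed
  then show ?thesis
    by (simp add: L1_space_def quotient_space_def)
qed

lemma smult_L1_class:
  assumes "integrable m f"
  shows "c \<odot>\<^bsub>L1_space m\<^esub> L1_class m f = L1_class m (\<lambda>x. c * f x)"
proof -
  have "(\<lambda>g x. c * g x) ` L1_class m f <+>\<^bsub>integrable_functions m\<^esub> null_functions m
      = L1_class m (\<lambda>x. c * f x)"
  proof (intro equalityI subsetI)
    fix k assume "k \<in> (\<lambda>g x. c * g x) ` L1_class m f <+>\<^bsub>integrable_functions m\<^esub> null_functions m"
    then show "k \<in> L1_class m (\<lambda>x. c * f x)"
      by (auto simp: set_add_def' L1_class_def integrable_functions_def null_functions_def)
  next
    fix k assume k: "k \<in> L1_class m (\<lambda>x. c * f x)"
    then have "(\<lambda>x. k x - c * f x) \<in> null_functions m"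
      using assms by (auto simp: L1_class_def null_functions_def)
    then show "k \<in> (\<lambda>g x. c * g x) ` L1_class m f <+>\<^bsub>integrable_functions m\<^esub> null_functions m"
      using L1_class_self[OF assms]
      unfolding set_add_def' UN_iff bex_simps
      by (intro bexI[of _ f] bexI[of _ "\<lambda>x. k x - c * f x"]) (auto simp: integrable_functions_def)
  qed
  then show ?thesis
    by (simp add: L1_space_def quotient_space_def) (simp add: integrable_functions_def)
qed

lemma integral_cong_L1_class:
  fixes \<Phi> :: "complex \<Rightarrow> 'b::{banach, second_countable_topology}"
  assumes "integrable m f" "g \<in> L1_class m f" "\<Phi> \<in> borel_measurable borel"
  shows "(LINT x|m. \<Phi> (g x)) = (LINT x|m. \<Phi> (f x))"
proof -
  have "f \<in> borel_measurable m" "g \<in> borel_measurable m"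
    using assms by (auto simp: L1_class_def)
  then show ?thesis
    using assms by (intro integral_cong_AE) (auto simp: L1_class_def)
qed

lemma vnorm_L1_class:
  assumes "integrable m f"
  shows "vnorm (L1_space m) (L1_class m f) = (LINT x|m. cmod (f x))"
proof -
  have "(\<lambda>g. LINT x|m. cmod (g x)) ` L1_class m f = (\<lambda>g. LINT x|m. cmod (f x)) ` L1_class m f"
    by (intro image_cong refl integral_cong_L1_class[OF assms]) auto
  also have "\<dots> = {LINT x|m. cmod (f x)}"
    by (rule image_constant[OF L1_class_self[OF assms]])
  finally have "(\<lambda>g. LINT x|m. cmod (g x)) ` L1_class m f = {LINT x|m. cmod (f x)}" .
  then show ?thesis
    by (simp add: L1_space_def quotient_space_def integrable_functions_def)
qed

lemma zero_L1_space: "\<zero>\<^bsub>L1_space m\<^esub> = L1_class m (\<lambda>x. 0)"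
  by (simp add: L1_space_def quotient_space_def null_functions_def L1_class_def)

text \<open>The group axioms for \<open>L1_space m\<close> enter as an assumption; the hypothesis of
  richness supplies them, since it includes the Daugavet property and with it the Banach space
  axioms.\<close>

lemma a_inv_L1_class:
  assumes "abelian_group (L1_space m)" "integrable m f"
  shows "\<ominus>\<^bsub>L1_space m\<^esub> L1_class m f = L1_class m (\<lambda>x. - f x)"
  using assms
  by (intro abelian_group.minus_equality)
    (auto simp: carrier_L1_space add_L1_class zero_L1_space)

lemma minus_L1_class:
  assumes "abelian_group (L1_space m)" "integrable m f" "integrable m g"
  shows "L1_class m f \<ominus>\<^bsub>L1_space m\<^esub> L1_class m g = L1_class m (\<lambda>x. f x - g x)"
  using assms by (simp add: a_minus_def a_inv_L1_class add_L1_class)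

text \<open>Integration over \<open>W\<close> as a functional on classes. The representative is
  chosen by \<open>SOME\<close>; for classes of integrable functions and measurable \<open>W\<close>
  the value does not depend on it.\<close>

definition restricted_integral :: "'a measure \<Rightarrow> 'a set \<Rightarrow> ('a \<Rightarrow> complex) set \<Rightarrow> complex" where
  "restricted_integral m W F = (LINT x|m. (SOME f. f \<in> F) x * indicator W x)"

lemma restricted_integral_L1_class:
  assumes "integrable m f" "W \<in> sets m"
  shows "restricted_integral m W (L1_class m f) = (LINT x|m. f x * indicator W x)"
proof -
  have g: "(SOME g. g \<in> L1_class m f) \<in> L1_class m f"
    using L1_class_self[OF assms(1)] by (rule someI[of "\<lambda>g. g \<in> L1_class m f"])
  then have "(SOME g. g \<in> L1_class m f) \<in> borel_measurable m"
    by (auto simp: L1_class_def)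
  with g show ?thesis
    unfolding restricted_integral_def using assms
    by (intro integral_cong_AE) (auto simp: L1_class_def)
qed

lemma restricted_integral_dual:
  assumes W: "W \<in> sets m"
  shows "restricted_integral m W \<in> dual_space (L1_space m)"
proof -
  have int: "integrable m (\<lambda>x. f x * indicator W x)" if "integrable m f" for f :: "_ \<Rightarrow> complex"
    using integrable_mult_indicator[OF W that]
    by (simp add: scaleR_conv_of_real mult.commute of_real_indicator)
  have "cmod (restricted_integral m W (L1_class m f)) \<le> 1 * vnorm (L1_space m) (L1_class m f)"
    if f: "integrable m f" for f
  proof -
    have "cmod (restricted_integral m W (L1_class m f)) \<le> (LINT x|m. cmod (f x * indicator W x))"
      unfolding restricted_integral_L1_class[OF f W] by (rule integral_norm_bound)
    also have "\<dots> \<le> (LINT x|m. cmod (f x))"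
      using f integrable_norm[OF int[OF f]]
      by (intro integral_mono) (simp_all add: norm_mult indicator_def)
    finally show ?thesis
      by (simp add: vnorm_L1_class f)
  qed
  then show ?thesis
    unfolding dual_space_def bounded_operator_def
    by (auto simp: complex_scalars_def carrier_L1_space add_L1_class smult_L1_class
        restricted_integral_L1_class W int distrib_right mult.assoc intro!: exI[of _ 1])
qed

text \<open>Narrowness of the quotient map, tested on one particular pair of unit vectors and one
  functional, and rewritten from cosets to functions.\<close>

lemma rich_L1_spectral_imp:
  fixes m :: "'g::{topological_ab_group_add, t2_space} measure"
  assumes rich: "rich (L1_space m) (L1_spectral m \<Lambda>)"
    and m: "finite_measure m" and W: "W \<in> sets m" "0 < measure m W" and e: "0 < e"
  defines "y \<equiv> \<lambda>x. complex_of_real (indicator W x / measure m W)"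
  obtains z w where "integrable m z" "integrable m w"
    "\<And>\<gamma>. \<gamma> \<in> dual_group - \<Lambda> \<Longrightarrow> fourier m w \<gamma> = 0"
    "(LINT x|m. cmod (z x)) = 1" "(LINT x|m. cmod (y x - z x - w x)) \<le> e"
    "cmod (LINT x|m. (y x - z x) * indicator W x) \<le> e" "2 - e \<le> (LINT x|m. cmod (z x - y x))"
proof -
  interpret finite_measure m by (rule m)
  let ?X = "L1_space m" and ?Y = "L1_spectral m \<Lambda>"
  have sub: "submodule ?Y complex_field ?X" and nar: "narrow ?X (quotient_space ?X ?Y) (\<lambda>x. ?Y +>\<^bsub>?X\<^esub> x)"
    using rich by (auto simp: rich_def closed_subspace_def)
  have ag: "abelian_group ?X"
    using nar unfolding narrow_def daugavet_property_def complex_banach_space_def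
      complex_normed_space_def module_def by blast
  have iy: "integrable m y"
    unfolding y_def using W
    by (intro integrable_of_real integrable_divide integrable_real_indicator) (auto simp: emeasure_eq_measure)
  have "(LINT x|m. cmod (y x)) = (LINT x|m. indicator W x / measure m W)"
    by (intro Bochner_Integration.integral_cong) (auto simp: y_def norm_divide indicator_def)
  then have y1: "(LINT x|m. cmod (y x)) = 1"
    using W by simp
  \<comment> \<open>With \<open>- y\<close> as the first unit vector, the lower bound for the norm
    of its sum with \<open>z\<close> becomes a lower bound for the distance from \<open>z\<close> to
    \<open>y\<close>.\<close>
  have "L1_class m y \<in> unit_sphere ?X" "L1_class m (\<lambda>x. - y x) \<in> unit_sphere ?X"
    using iy y1 by (auto simp: unit_sphere_def carrier_L1_space vnorm_L1_class)
  \<comment> \<open>The quotient norm is an infimum that need not be attained; halving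
    \<open>e\<close> leaves a strict inequality, so that some element of the coset has norm below
    \<open>e\<close>.\<close>
  moreover have "0 < e / 2"
    using e by simp
  ultimately obtain Z where Z: "Z \<in> unit_sphere ?X"
    "vnorm (quotient_space ?X ?Y) (?Y +>\<^bsub>?X\<^esub> (L1_class m y \<ominus>\<^bsub>?X\<^esub> Z))
      + cmod (restricted_integral m W (L1_class m y \<ominus>\<^bsub>?X\<^esub> Z)) \<le> e / 2"
    "2 - e / 2 \<le> vnorm ?X (L1_class m (\<lambda>x. - y x) \<oplus>\<^bsub>?X\<^esub> Z)"
    using nar restricted_integral_dual[OF W(1)] unfolding narrow_def by blast
  then obtain z where z: "integrable m z" "Z = L1_class m z"
    by (auto simp: unit_sphere_def carrier_L1_space)
  have D: "L1_class m y \<ominus>\<^bsub>?X\<^esub> Z = L1_class m (\<lambda>x. y x - z x)"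
    using z ag iy by (simp add: minus_L1_class)
  have zero: "\<zero>\<^bsub>?X\<^esub> \<in> ?Y"
    using subgroup.one_closed[OF submodule.axioms(1)[OF sub]] by simp
  have Ysub: "?Y \<subseteq> carrier ?X"
    by (auto simp: L1_spectral_def)
  let ?C = "?Y +>\<^bsub>?X\<^esub> L1_class m (\<lambda>x. y x - z x)"
  have C: "?C = (\<lambda>s. s \<oplus>\<^bsub>?X\<^esub> L1_class m (\<lambda>x. y x - z x)) ` ?Y"
    by (auto simp: a_r_coset_def')
  have I: "(INF a\<in>?C. vnorm ?X a) + cmod (restricted_integral m W (L1_class m (\<lambda>x. y x - z x))) \<le> e / 2"
    using Z(2) unfolding D by (simp add: quotient_space_def)
  have "0 \<le> (INF a\<in>?C. vnorm ?X a)"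
    using Ysub zero z iy
    by (intro cINF_greatest) (auto simp: C carrier_L1_space add_L1_class vnorm_L1_class)
  then have c: "cmod (LINT x|m. (y x - z x) * indicator W x) \<le> e"
    using I e z iy W by (simp add: restricted_integral_L1_class)
  have "(INF a\<in>?C. vnorm ?X a) < e"
    using I e norm_ge_zero[of "restricted_integral m W (L1_class m (\<lambda>x. y x - z x))"] by linarith
  then obtain a where a: "a \<in> ?C" "vnorm ?X a < e"
    using zero cInf_lessD[of "vnorm ?X ` ?C" e] by (auto simp: C)
  then obtain s where s: "s \<in> ?Y" "vnorm ?X (s \<oplus>\<^bsub>?X\<^esub> L1_class m (\<lambda>x. y x - z x)) < e"
    by (auto simp: C)
  then obtain w where w: "integrable m w" "s = L1_class m w"
    using Ysub by (auto simp: carrier_L1_space)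
  show thesis
  \<comment> \<open>The coset element is \<open>w\<close> plus \<open>y - z\<close>, so the
    approximant of \<open>y - z\<close> is \<open>- w\<close>.\<close>
  proof (rule that[of z "\<lambda>x. - w x"])
    show "fourier m (\<lambda>x. - w x) \<gamma> = 0" if "\<gamma> \<in> dual_group - \<Lambda>" for \<gamma>
    proof -
      have "fourier m w \<gamma> = 0"
        using s(1) L1_class_self[OF w(1)] that by (auto simp: L1_spectral_def w(2))
      then show ?thesis
        by (simp add: fourier_def)
    qed
    show "(LINT x|m. cmod (z x)) = 1"
      using Z(1) z by (simp add: unit_sphere_def vnorm_L1_class)
    show "(LINT x|m. cmod (y x - z x - - w x)) \<le> e"
      using s(2) w z iy by (simp add: add_L1_class vnorm_L1_class algebra_simps)
    show "2 - e \<le> (LINT x|m. cmod (z x - y x))"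
      using Z(3) z iy e by (simp add: add_L1_class vnorm_L1_class algebra_simps)
  qed (use z w c in auto)
qed

section \<open>Quotients of normed spaces\<close>

lemma cring_complex_field: "cring complex_field"
proof (rule cringI)
  show "abelian_group complex_field"
    by (rule abelian_groupI) (auto simp: complex_field_def intro: left_minus)
  show "Group.comm_monoid complex_field"
    by (simp add: complex_field_def Group.monoid.intro monoid.monoid_comm_monoidI)
qed (auto simp: complex_field_def distrib_right)

lemma complex_field_simps [simp]:
  "carrier complex_field = UNIV" "a \<oplus>\<^bsub>complex_field\<^esub> b = a + b"
  "a \<otimes>\<^bsub>complex_field\<^esub> b = a * b" "\<one>\<^bsub>complex_field\<^esub> = 1" "\<zero>\<^bsub>complex_field\<^esub> = 0"
  by (simp_all add: complex_field_def)

lemma a_inv_complex_field [simp]: "\<ominus>\<^bsub>complex_field\<^esub> a = - a"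
proof -
  interpret cring complex_field by (rule cring_complex_field)
  show ?thesis by (rule minus_equality) auto
qed

section \<open>The metric of a normed space and geometric Cauchy sequences\<close>

context complex_normed_space
begin

lemma vnorm_zero [simp]: "vnorm X \<zero> = 0"
  using vnorm_eq_0[of \<zero>] by simp

lemma vnorm_a_inv: "x \<in> carrier X \<Longrightarrow> vnorm X (\<ominus> x) = vnorm X x"
  using smult_l_minus[of 1 x] vnorm_smult[of x "- 1"] smult_one[of x] by simp

lemma metric_space_vdist: "Metric_space (carrier X) (vdist X)"
proof
  show "0 \<le> vdist X x y" for x y
    by (simp add: vdist_def vnorm_nonneg)
  show "vdist X x y = vdist X y x" for x y
    using vnorm_a_inv[of "x \<ominus> y"] by (auto simp: vdist_def a_minus_def minus_add M.a_comm)
  show "vdist X x y = 0 \<longleftrightarrow> x = y" if "x \<in> carrier X" "y \<in> carrier X" for x y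
    using that M.minus_equality[of x "\<ominus> y"]
    by (auto simp: vdist_def vnorm_eq_0 a_minus_def M.r_neg)
  show "vdist X x z \<le> vdist X x y + vdist X y z"
    if "x \<in> carrier X" "y \<in> carrier X" "z \<in> carrier X" for x y z
  proof -
    have "x \<ominus> z = (x \<ominus> y) \<oplus> (y \<ominus> z)"
      using that by (simp add: a_minus_def M.a_ac M.r_neg1 M.r_neg2)
    then show ?thesis
      using that vnorm_triangle[of "x \<ominus> y" "y \<ominus> z"] by (simp add: vdist_def)
  qed
qed

end

text \<open>The distances telescope: from index \<open>n\<close> on they sum to at most
  \<open>2 * (1/2) ^ n\<close>, the tail of the geometric series.\<close>

lemma (in Metric_space) MCauchy_geometric:
  assumes "range \<sigma> \<subseteq> M" "\<And>n. d (\<sigma> n) (\<sigma> (Suc n)) \<le> (1/2) ^ n"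
  shows "MCauchy \<sigma>"
proof -
  have M: "\<sigma> n \<in> M" for n
    using assms(1) by blast
  have bound: "d (\<sigma> n) (\<sigma> (n + k)) \<le> 2 * (1/2) ^ n - 2 * (1/2) ^ (n + k)" for n k
  proof (induction k)
    case 0
    then show ?case using M by simp
  next
    case (Suc k)
    have "d (\<sigma> n) (\<sigma> (n + Suc k)) \<le> d (\<sigma> n) (\<sigma> (n + k)) + d (\<sigma> (n + k)) (\<sigma> (Suc (n + k)))"
      using triangle[OF M M M] by simp
    also have "\<dots> \<le> (2 * (1/2) ^ n - 2 * (1/2) ^ (n + k)) + (1/2) ^ (n + k)"
      by (intro add_mono Suc assms)
    finally show ?case by simp
  qed
  have tail: "d (\<sigma> n) (\<sigma> n') \<le> 2 * (1/2) ^ N" if "N \<le> n" "n \<le> n'" for N n n'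
  proof -
    have "d (\<sigma> n) (\<sigma> n') \<le> 2 * (1/2) ^ n - 2 * (1/2) ^ n'"
      using bound[of n "n' - n"] that by simp
    also have "\<dots> \<le> 2 * (1/2) ^ n"
      by simp
    also have "\<dots> \<le> 2 * (1/2) ^ N"
      using that by (simp add: power_decreasing)
    finally show ?thesis .
  qed
  show ?thesis
    unfolding MCauchy_def
  proof (intro conjI assms allI impI)
    fix \<epsilon> :: real assume "\<epsilon> > 0"
    then obtain N where N: "(1/2::real) ^ N < \<epsilon> / 2"
      using real_arch_pow_inv[of "\<epsilon> / 2" "1/2"] by auto
    have "d (\<sigma> n) (\<sigma> n') < \<epsilon>" if "N \<le> n" "N \<le> n'" for n n'
    proof (cases "n \<le> n'")
      case True
      then show ?thesis using tail[OF that(1) True] N by simp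
    next
      case False
      then show ?thesis using tail[OF that(2), of n] N commute[of "\<sigma> n" "\<sigma> n'"] by simp
    qed
    then show "\<exists>N. \<forall>n n'. N \<le> n \<longrightarrow> N \<le> n' \<longrightarrow> d (\<sigma> n) (\<sigma> n') < \<epsilon>"
      by blast
  qed
qed

section \<open>Quotient by a closed subspace: norm, operations, completeness\<close>

locale normed_quotient = complex_normed_space +
  fixes Y assumes closed_subspace: "closed_subspace Y X"
begin

sublocale metric: Metric_space "carrier X" "vdist X"
  by (rule metric_space_vdist)

lemma submodule: "submodule Y complex_field X"
  using closed_subspace by (simp add: closed_subspace_def)

sublocale abelian_subgroup Y X
  using submodule by (intro abelian_subgroupI3 additive_subgroupI) (auto simp: submodule_def module.axioms(2)[OF module_axioms])

abbreviation Q where "Q \<equiv> quotient_space X Y"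
abbreviation proj where "proj x \<equiv> Y +> x"

lemma zero_mem: "\<zero> \<in> Y"
  using subgroup.one_closed[OF submodule.axioms(1)[OF submodule]] by simp

lemma smult_mem: "h \<in> Y \<Longrightarrow> c \<odot> h \<in> Y"
  using submodule.smult_closed[OF submodule] by simp

lemma mem_carrier [simp]: "h \<in> Y \<Longrightarrow> h \<in> carrier X"
  using a_subset by blast

lemma carrier_quotient: "carrier Q = proj ` carrier X"
  by (auto simp: quotient_space_def A_RCOSETS_def')

lemma proj_closed [simp]: "x \<in> carrier X \<Longrightarrow> proj x \<in> carrier Q"
  by (simp add: carrier_quotient)

lemma zero_quotient: "\<zero>\<^bsub>Q\<^esub> = proj \<zero>"
  using a_subset by (simp add: quotient_space_def)

lemma add_quotient:
  "x \<in> carrier X \<Longrightarrow> y \<in> carrier X \<Longrightarrow> proj x \<oplus>\<^bsub>Q\<^esub> proj y = proj (x \<oplus> y)"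
  by (simp add: quotient_space_def a_rcos_sum)

lemma smult_quotient:
  assumes x: "x \<in> carrier X"
  shows "c \<odot>\<^bsub>Q\<^esub> proj x = proj (c \<odot> x)"
proof -
  have "(\<lambda>a. c \<odot> a) ` proj x <+>\<^bsub>X\<^esub> Y = proj (c \<odot> x)"
  proof (intro equalityI subsetI)
    fix a assume "a \<in> (\<lambda>a. c \<odot> a) ` proj x <+>\<^bsub>X\<^esub> Y"
    then obtain h k where hk: "h \<in> Y" "k \<in> Y" "a = c \<odot> (h \<oplus> x) \<oplus> k"
      by (auto simp: set_add_def' a_r_coset_def')
    then have "a = (c \<odot> h \<oplus> k) \<oplus> c \<odot> x"
      using x by (simp add: smult_r_distr M.a_ac)
    then show "a \<in> proj (c \<odot> x)"
      using hk smult_mem by (auto simp: a_r_coset_def')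
  next
    fix a assume "a \<in> proj (c \<odot> x)"
    then obtain h where h: "h \<in> Y" "a = h \<oplus> c \<odot> x"
      by (auto simp: a_r_coset_def')
    then have "a = c \<odot> (\<zero> \<oplus> x) \<oplus> h"
      using x by (simp add: M.a_comm)
    moreover have "\<zero> \<oplus> x \<in> proj x"
      unfolding a_r_coset_def' using zero_mem by blast
    ultimately show "a \<in> (\<lambda>a. c \<odot> a) ` proj x <+>\<^bsub>X\<^esub> Y"
      unfolding set_add_def' using h(1) by blast
  qed
  then show ?thesis
    by (simp add: quotient_space_def)
qed

lemma abelian_group_quotient: "abelian_group Q"
proof (rule abelian_groupI)
  fix u assume "u \<in> carrier Q"
  then obtain x where "x \<in> carrier X" "u = proj x"
    by (auto simp: carrier_quotient)
  then show "\<exists>v\<in>carrier Q. v \<oplus>\<^bsub>Q\<^esub> u = \<zero>\<^bsub>Q\<^esub>"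
    by (intro bexI[of _ "proj (\<ominus> x)"]) (simp_all add: add_quotient zero_quotient M.l_neg)
qed (auto simp: carrier_quotient add_quotient zero_quotient M.a_ac)

lemma vnorm_quotient: "vnorm Q (proj x) = (INF h\<in>Y. vnorm X (h \<oplus> x))"
proof -
  have "proj x = (\<lambda>h. h \<oplus> x) ` Y"
    by (auto simp: a_r_coset_def')
  then show ?thesis
    by (simp add: quotient_space_def image_image)
qed

lemma vnorm_quotient_le: "h \<in> Y \<Longrightarrow> x \<in> carrier X \<Longrightarrow> vnorm Q (proj x) \<le> vnorm X (h \<oplus> x)"
  unfolding vnorm_quotient
  by (rule cINF_lower) (auto simp: bdd_below_def intro!: exI[of _ 0] vnorm_nonneg)

lemma vnorm_quotient_le_vnorm: "x \<in> carrier X \<Longrightarrow> vnorm Q (proj x) \<le> vnorm X x"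
  using vnorm_quotient_le[OF zero_mem, of x] by simp

lemma vnorm_quotient_ge:
  "(\<And>h. h \<in> Y \<Longrightarrow> r \<le> vnorm X (h \<oplus> x)) \<Longrightarrow> r \<le> vnorm Q (proj x)"
  unfolding vnorm_quotient using zero_mem by (intro cINF_greatest) blast+

lemma vnorm_quotient_less:
  assumes "vnorm Q (proj x) < r"
  obtains h where "h \<in> Y" "vnorm X (h \<oplus> x) < r"
  using assms vnorm_quotient_ge[of r x] by (meson not_le)

lemma proj_minus:
  assumes "x \<in> carrier X" "y \<in> carrier X"
  shows "proj x \<ominus>\<^bsub>Q\<^esub> proj y = proj (x \<ominus> y)"
proof -
  have "\<ominus>\<^bsub>Q\<^esub> proj y = proj (\<ominus> y)"
    using assms by (intro abelian_group.minus_equality[OF abelian_group_quotient])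
      (auto simp: add_quotient zero_quotient M.l_neg)
  then show ?thesis
    using assms by (simp add: a_minus_def add_quotient)
qed

text \<open>Closedness of \<open>Y\<close> makes the quotient seminorm a norm: a point outside
  \<open>Y\<close> has a ball free of \<open>Y\<close>, while a vanishing quotient norm puts some
  \<open>\<ominus> h\<close> with \<open>h \<in> Y\<close> into that ball.\<close>

lemma vnorm_quotient_eq_0:
  assumes x: "x \<in> carrier X" and 0: "vnorm Q (proj x) = 0"
  shows "x \<in> Y"
proof (rule ccontr)
  assume "x \<notin> Y"
  then obtain r where r: "r > 0" "disjnt Y (metric.mball x r)"
    using closed_subspace x unfolding closed_subspace_def metric.closedin_metric by blast
  obtain h where h: "h \<in> Y" "vnorm X (h \<oplus> x) < r"
    using vnorm_quotient_less[of x r] 0 r by auto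
  have "\<ominus> h \<in> metric.mball x r"
    using h x by (simp add: metric.in_mball vdist_def a_minus_def M.a_comm)
  moreover have "\<ominus> h \<in> Y"
    using h by simp
  ultimately show False
    using r(2) by (auto simp: disjnt_def)
qed

lemma vnorm_quotient_smult_le:
  assumes x: "x \<in> carrier X"
  shows "vnorm Q (proj (c \<odot> x)) \<le> cmod c * vnorm Q (proj x)"
proof (cases "c = 0")
  case True
  have "c \<odot> x = \<zero>"
    using smult_l_null[OF x] True by simp
  then show ?thesis
    using vnorm_quotient_le_vnorm[of \<zero>] True by simp
next
  case False
  have "vnorm Q (proj (c \<odot> x)) / cmod c \<le> vnorm Q (proj x)"
  proof (rule vnorm_quotient_ge)
    fix h assume h: "h \<in> Y"
    have "vnorm Q (proj (c \<odot> x)) \<le> vnorm X (c \<odot> h \<oplus> c \<odot> x)"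
      using h x smult_mem by (intro vnorm_quotient_le) auto
    also have "\<dots> = cmod c * vnorm X (h \<oplus> x)"
      using h x vnorm_smult[of "h \<oplus> x" c] by (simp add: smult_r_distr)
    finally show "vnorm Q (proj (c \<odot> x)) / cmod c \<le> vnorm X (h \<oplus> x)"
      using False by (simp add: divide_le_eq mult.commute)
  qed
  then show ?thesis
    using False by (simp add: divide_le_eq mult.commute)
qed

lemma vnorm_quotient_smult:
  assumes x: "x \<in> carrier X"
  shows "vnorm Q (proj (c \<odot> x)) = cmod c * vnorm Q (proj x)"
proof (cases "c = 0")
  case True
  then show ?thesis
    using vnorm_quotient_smult_le[OF x, of c] vnorm_quotient_ge[of 0 "c \<odot> x"] x vnorm_nonneg
    by (auto intro!: antisym)
next
  case False
  \<comment> \<open>The reverse inequality is the one already known, applied to the scalar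
    \<open>inverse c\<close> and the vector \<open>c \<odot> x\<close>.\<close>
  have "inverse c \<odot> (c \<odot> x) = x"
    using smult_assoc1[of "inverse c" c x] smult_one[OF x] x False by simp
  then have "vnorm Q (proj x) \<le> cmod (inverse c) * vnorm Q (proj (c \<odot> x))"
    using vnorm_quotient_smult_le[of "c \<odot> x" "inverse c"] x by simp
  then have "cmod c * vnorm Q (proj x) \<le> cmod c * (cmod (inverse c) * vnorm Q (proj (c \<odot> x)))"
    by (intro mult_left_mono) auto
  also have "\<dots> = vnorm Q (proj (c \<odot> x))"
    using False by (simp add: norm_inverse)
  finally have "cmod c * vnorm Q (proj x) \<le> vnorm Q (proj (c \<odot> x))" .
  then show ?thesis
    using vnorm_quotient_smult_le[OF x, of c] by simp
qed

lemma vnorm_quotient_triangle: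
  assumes x: "x \<in> carrier X" and y: "y \<in> carrier X"
  shows "vnorm Q (proj (x \<oplus> y)) \<le> vnorm Q (proj x) + vnorm Q (proj y)"
proof -
  \<comment> \<open>The two infima on the right are treated one after the other, each with the
    representative of the other class held fixed.\<close>
  have "vnorm Q (proj (x \<oplus> y)) - vnorm Q (proj y) \<le> vnorm Q (proj x)"
  proof (rule vnorm_quotient_ge)
    fix h assume h: "h \<in> Y"
    have "vnorm Q (proj (x \<oplus> y)) - vnorm X (h \<oplus> x) \<le> vnorm Q (proj y)"
    proof (rule vnorm_quotient_ge)
      fix k assume k: "k \<in> Y"
      have "vnorm Q (proj (x \<oplus> y)) \<le> vnorm X ((h \<oplus> k) \<oplus> (x \<oplus> y))"
        using h k x y by (intro vnorm_quotient_le) auto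
      also have "(h \<oplus> k) \<oplus> (x \<oplus> y) = (h \<oplus> x) \<oplus> (k \<oplus> y)"
        using h k x y by (simp add: M.a_ac)
      also have "vnorm X \<dots> \<le> vnorm X (h \<oplus> x) + vnorm X (k \<oplus> y)"
        using h k x y by (intro vnorm_triangle) auto
      finally show "vnorm Q (proj (x \<oplus> y)) - vnorm X (h \<oplus> x) \<le> vnorm X (k \<oplus> y)"
        by simp
    qed
    then show "vnorm Q (proj (x \<oplus> y)) - vnorm Q (proj y) \<le> vnorm X (h \<oplus> x)"
      by simp
  qed
  then show ?thesis by simp
qed

lemma proj_eq_zero_iff: "x \<in> carrier X \<Longrightarrow> proj x = proj \<zero> \<longleftrightarrow> x \<in> Y"
  using a_rcos_const a_rcos_self[of x] a_coset_add_zero[OF a_subset] by auto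

lemma complex_normed_space_quotient: "complex_normed_space Q"
proof -
  have "module complex_field Q"
  proof (rule moduleI[OF cring_complex_field abelian_group_quotient])
    fix c d u v assume "u \<in> carrier Q" "v \<in> carrier Q"
    then obtain x y where xy: "x \<in> carrier X" "y \<in> carrier X" "u = proj x" "v = proj y"
      by (auto simp: carrier_quotient)
    show "c \<odot>\<^bsub>Q\<^esub> (u \<oplus>\<^bsub>Q\<^esub> v) = (c \<odot>\<^bsub>Q\<^esub> u) \<oplus>\<^bsub>Q\<^esub> (c \<odot>\<^bsub>Q\<^esub> v)"
      using xy by (simp add: add_quotient smult_quotient smult_r_distr)
  next
    fix c d u assume "u \<in> carrier Q"
    then obtain x where xy: "x \<in> carrier X" "u = proj x"
      by (auto simp: carrier_quotient)
    show "c \<odot>\<^bsub>Q\<^esub> u \<in> carrier Q"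
      using xy by (simp add: smult_quotient)
    show "(c \<oplus>\<^bsub>complex_field\<^esub> d) \<odot>\<^bsub>Q\<^esub> u = (c \<odot>\<^bsub>Q\<^esub> u) \<oplus>\<^bsub>Q\<^esub> (d \<odot>\<^bsub>Q\<^esub> u)"
      using xy smult_l_distr[of c d x] by (simp add: add_quotient smult_quotient)
    show "(c \<otimes>\<^bsub>complex_field\<^esub> d) \<odot>\<^bsub>Q\<^esub> u = c \<odot>\<^bsub>Q\<^esub> (d \<odot>\<^bsub>Q\<^esub> u)"
      using xy smult_assoc1[of c d x] by (simp add: smult_quotient)
    show "\<one>\<^bsub>complex_field\<^esub> \<odot>\<^bsub>Q\<^esub> u = u"
      using xy smult_one[of x] by (simp add: smult_quotient)
  qed
  then show ?thesis
  proof (rule complex_normed_space.intro, unfold_locales)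
    fix c u assume "u \<in> carrier Q"
    then obtain x where x: "x \<in> carrier X" "u = proj x"
      by (auto simp: carrier_quotient)
    show "0 \<le> vnorm Q u"
      unfolding x(2) using x(1) by (intro vnorm_quotient_ge vnorm_nonneg) auto
    show "vnorm Q (c \<odot>\<^bsub>Q\<^esub> u) = cmod c * vnorm Q u"
      using x by (simp add: smult_quotient vnorm_quotient_smult)
    have "vnorm Q (proj x) = 0" if "x \<in> Y"
      using vnorm_quotient_smult[of \<zero> 0] proj_eq_zero_iff[OF x(1)] that by simp
    then show "vnorm Q u = 0 \<longleftrightarrow> u = \<zero>\<^bsub>Q\<^esub>"
      using vnorm_quotient_eq_0[OF x(1)] proj_eq_zero_iff[OF x(1)] x by (auto simp: zero_quotient)
  next
    fix u v assume "u \<in> carrier Q" "v \<in> carrier Q"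
    then show "vnorm Q (u \<oplus>\<^bsub>Q\<^esub> v) \<le> vnorm Q u + vnorm Q v"
      by (auto simp: carrier_quotient add_quotient vnorm_quotient_triangle)
  qed
qed

lemma bounded_operator_proj: "bounded_operator X Q proj"
  unfolding bounded_operator_def
  by (auto simp: add_quotient smult_quotient intro!: exI[of _ 1] vnorm_quotient_le_vnorm)

text \<open>Lifts to \<open>X\<close> a rapidly converging subsequence of a Cauchy sequence in the quotient.\<close>

lemma mcomplete_quotient:
  assumes complete: "metric.mcomplete"
  shows "Metric_space.mcomplete (carrier Q) (vdist Q)"
proof -
  interpret q: Metric_space "carrier Q" "vdist Q"
    by (rule complex_normed_space.metric_space_vdist[OF complex_normed_space_quotient])
  have dist: "vdist Q (proj x) (proj y) = vnorm Q (proj (x \<ominus> y))"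
    if "x \<in> carrier X" "y \<in> carrier X" for x y
    using that by (simp add: vdist_def proj_minus)
  show ?thesis
    unfolding q.mcomplete_def
  proof (intro allI impI)
    fix \<sigma> assume C: "q.MCauchy \<sigma>"
    then have \<sigma>: "\<sigma> n \<in> carrier Q" for n
      unfolding q.MCauchy_def by (meson rangeI subsetD)
    have "\<exists>N. \<forall>n n'. N \<le> n \<longrightarrow> N \<le> n' \<longrightarrow> vdist Q (\<sigma> n) (\<sigma> n') < (1/2) ^ k" for k :: nat
      using C unfolding q.MCauchy_def by simp
    then have "\<forall>k. \<exists>N. \<forall>n n'. N \<le> n \<longrightarrow> N \<le> n' \<longrightarrow> vdist Q (\<sigma> n) (\<sigma> n') < (1/2) ^ k" ..
    from choice[OF this] obtain N
      where N: "\<forall>k n n'. N k \<le> n \<longrightarrow> N k \<le> n' \<longrightarrow> vdist Q (\<sigma> n) (\<sigma> n') < (1/2) ^ k" ..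
    \<comment> \<open>Strictly increasing indices with \<open>N k \<le> r k\<close>, so that
      consecutive terms of the subsequence are closer than \<open>(1/2) ^ k\<close>.\<close>
    define r where "r = rec_nat (N 0) (\<lambda>k i. max (Suc i) (N (Suc k)))"
    have rS: "r (Suc k) = max (Suc (r k)) (N (Suc k))" and r0: "r 0 = N 0" for k
      by (simp_all add: r_def)
    have r: "N k \<le> r k" "r k < r (Suc k)" for k
      by (cases k) (simp_all add: rS r0 less_max_iff_disj)
    have mono: "strict_mono r"
      using r by (simp add: strict_mono_Suc_iff)
    have step: "vdist Q (\<sigma> (r k)) (\<sigma> (r (Suc k))) < (1/2) ^ k" for k
      using N r[of k] by simp
    have "\<exists>x. \<forall>k. (x k \<in> carrier X \<and> proj (x k) = \<sigma> (r k)) \<and> vdist X (x k) (x (Suc k)) \<le> (1/2) ^ k"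
    proof (rule dependent_nat_choice)
      show "\<exists>x. x \<in> carrier X \<and> proj x = \<sigma> (r 0)"
        using \<sigma>[of "r 0"] by (auto simp: carrier_quotient)
    next
      fix x k assume x: "x \<in> carrier X \<and> proj x = \<sigma> (r k)"
      obtain y where y: "y \<in> carrier X" "proj y = \<sigma> (r (Suc k))"
        using \<sigma>[of "r (Suc k)"] by (auto simp: carrier_quotient)
      have "vnorm Q (proj (x \<ominus> y)) < (1/2) ^ k"
        using step[of k] x y dist[of x y] by simp
      then obtain h where h: "h \<in> Y" "vnorm X (h \<oplus> (x \<ominus> y)) < (1/2) ^ k"
        by (rule vnorm_quotient_less)
      \<comment> \<open>Subtracting \<open>h\<close> keeps the class of \<open>y\<close> and
        realises the small quotient distance as a distance in \<open>X\<close>.\<close>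
      let ?y = "\<ominus> h \<oplus> y"
      have "proj ?y = proj (\<ominus> h) \<oplus>\<^bsub>Q\<^esub> proj y"
        using h y(1) by (simp add: add_quotient)
      also have "proj (\<ominus> h) = proj \<zero>"
        using h by (simp add: proj_eq_zero_iff)
      also have "proj \<zero> \<oplus>\<^bsub>Q\<^esub> proj y = proj y"
        using y(1) by (simp add: add_quotient)
      finally have "proj ?y = \<sigma> (r (Suc k))"
        using y by simp
      moreover have "x \<ominus> ?y = h \<oplus> (x \<ominus> y)"
        using x y h by (simp add: a_minus_def minus_add M.a_ac)
      ultimately show "\<exists>y. (y \<in> carrier X \<and> proj y = \<sigma> (r (Suc k))) \<and> vdist X x y \<le> (1/2) ^ k"
        using x y h by (intro exI[of _ ?y]) (auto simp: vdist_def)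
    qed
    then obtain x where x: "\<And>k. x k \<in> carrier X" "\<And>k. proj (x k) = \<sigma> (r k)"
      "\<And>k. vdist X (x k) (x (Suc k)) \<le> (1/2) ^ k"
      by blast
    have "metric.MCauchy x"
      using x by (intro metric.MCauchy_geometric) auto
    then obtain l where l: "limitin metric.mtopology x l sequentially"
      using complete by (auto simp: metric.mcomplete_def)
    then have lc: "l \<in> carrier X"
      by (simp add: metric.limitin_mspace)
    have "limitin q.mtopology (\<sigma> \<circ> r) (proj l) sequentially"
      unfolding q.limitin_metric
    proof (intro conjI allI impI)
      fix e :: real assume "e > 0"
      then have "\<forall>\<^sub>F k in sequentially. x k \<in> carrier X \<and> vdist X (x k) l < e"
        using l by (simp add: metric.limitin_metric)
      then show "\<forall>\<^sub>F k in sequentially. (\<sigma> \<circ> r) k \<in> carrier Q \<and> vdist Q ((\<sigma> \<circ> r) k) (proj l) < e"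
      proof eventually_elim
        case (elim k)
        then have "vnorm Q (proj (x k \<ominus> l)) < e"
          using lc vnorm_quotient_le_vnorm[of "x k \<ominus> l"]
            by (auto simp: vdist_def)
        then show ?case
          using \<sigma> dist[of "x k" l] x lc by simp
      qed
    qed (use lc in simp)
    then show "\<exists>l. limitin q.mtopology \<sigma> l sequentially"
      using q.MCauchy_convergent_subsequence[OF C mono] by blast
  qed
qed

end

lemma complex_banach_space_quotient:
  assumes "complex_banach_space X" "closed_subspace Y X"
  shows "complex_banach_space (quotient_space X Y)"
proof -
  interpret complex_banach_space X by fact
  interpret normed_quotient X Y
    by unfold_locales fact
  show ?thesis
    by (intro complex_banach_space.intro complex_normed_space_quotient complex_banach_space_axioms.intro
        mcomplete_quotient complete)
qed

section \<open>The space of continuous functions\<close>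

definition bcontfun_scale :: "complex \<Rightarrow> ('a::topological_space \<Rightarrow>\<^sub>C complex) \<Rightarrow> 'a \<Rightarrow>\<^sub>C complex" where
  "bcontfun_scale c f = Bcontfun (\<lambda>x. c * apply_bcontfun f x)"

lemma apply_bcontfun_scale [simp]:
  "apply_bcontfun (bcontfun_scale c f) x = c * apply_bcontfun f x"
proof -
  have "(\<lambda>x. c * apply_bcontfun f x) \<in> bcontfun"
    by (intro bcontfun_normI[of _ "cmod c * norm f"] continuous_intros continuous_on_apply_bcontfun)
      (simp add: norm_mult mult_left_mono norm_bounded)
  then show ?thesis
    by (simp add: bcontfun_scale_def Bcontfun_inverse)
qed

lemma norm_bcontfun_scale: "norm (bcontfun_scale c f) = cmod c * norm f"
proof -
  have le: "norm (bcontfun_scale c f) \<le> cmod c * norm f" for c and f :: "'a \<Rightarrow>\<^sub>C complex"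
    by (rule norm_bound) (simp add: norm_mult mult_left_mono norm_bounded)
  show ?thesis
  proof (cases "c = 0")
    case True
    then show ?thesis using le[of c f] by simp
  next
    case False
    have "bcontfun_scale (inverse c) (bcontfun_scale c f) = f"
      using False by (intro bcontfun_eqI) simp
    then have "norm f \<le> cmod (inverse c) * norm (bcontfun_scale c f)"
      using le[of "inverse c" "bcontfun_scale c f"] by simp
    then have "cmod c * norm f \<le> cmod c * (cmod (inverse c) * norm (bcontfun_scale c f))"
      by (intro mult_left_mono) auto
    also have "\<dots> = norm (bcontfun_scale c f)"
      using False by (simp add: norm_inverse)
    finally show ?thesis using le[of c f] by simp
  qed
qed

lemma C_space_simps [simp]:
  "carrier C_space = UNIV" "\<zero>\<^bsub>C_space\<^esub> = 0" "f \<oplus>\<^bsub>C_space\<^esub> g = f + g"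
  "c \<odot>\<^bsub>C_space\<^esub> f = bcontfun_scale c f" "vnorm C_space f = norm f"
  by (simp_all add: C_space_def bcontfun_scale_def)

lemma abelian_group_C_space: "abelian_group C_space"
proof (rule abelian_groupI)
  fix f :: "'a \<Rightarrow>\<^sub>C complex"
  show "\<exists>g\<in>carrier C_space. g \<oplus>\<^bsub>C_space\<^esub> f = \<zero>\<^bsub>C_space\<^esub>"
    by (intro bexI[of _ "- f"]) simp_all
qed (simp_all add: add_ac)

lemma minus_C_space [simp]: "f \<ominus>\<^bsub>C_space\<^esub> g = f - g"
proof -
  have "\<ominus>\<^bsub>C_space\<^esub> g = - g"
    by (rule abelian_group.minus_equality[OF abelian_group_C_space]) auto
  then show ?thesis by (simp add: a_minus_def)
qed

lemma vdist_C_space: "vdist C_space = dist"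
  by (intro ext) (simp add: vdist_def dist_norm)

lemma complex_banach_space_C_space:
  "complex_banach_space (C_space :: ('a::topological_space \<Rightarrow>\<^sub>C complex) normed_module)"
proof -
  have "module complex_field (C_space :: ('a \<Rightarrow>\<^sub>C complex) normed_module)"
    by (rule moduleI[OF cring_complex_field abelian_group_C_space])
      (auto intro!: bcontfun_eqI simp: algebra_simps)
  moreover have "Met_TC.mcomplete (TYPE('a \<Rightarrow>\<^sub>C complex))"
    unfolding Met_TC.mcomplete_def
  proof (intro allI impI)
    fix \<sigma> :: "nat \<Rightarrow> 'a \<Rightarrow>\<^sub>C complex"
    assume C: "Met_TC.MCauchy \<sigma>"
    \<comment> \<open>The conjunct \<open>True\<close> instantiates the side predicate of
      \<open>uniformly_convergent_eq_cauchy\<close>: convergence is uniform on the whole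
      space.\<close>
    have "\<exists>l. \<forall>e>0. \<exists>N. \<forall>n x. N \<le> n \<and> True \<longrightarrow> dist (\<sigma> n x) (l x) < e"
      using C unfolding Met_TC.MCauchy_def uniformly_convergent_eq_cauchy
      by (meson dist_fun_lt_imp_dist_val_lt)
    then obtain l where "\<forall>e>0. \<exists>N. \<forall>n x. N \<le> n \<and> True \<longrightarrow> dist (\<sigma> n x) (l x) < e" ..
    then have "uniform_limit UNIV (\<lambda>n. apply_bcontfun (\<sigma> n)) l sequentially"
      unfolding uniform_limit_sequentially_iff by blast
    from uniform_limit_bcontfunE[OF this sequentially_bot]
    show "\<exists>l. limitin Met_TC.mtopology \<sigma> l sequentially"
      by auto
  qed
  ultimately show ?thesis
    unfolding complex_banach_space_def complex_normed_space_def complex_normed_space_axioms_def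
      complex_banach_space_axioms_def
    by (simp add: vdist_C_space norm_bcontfun_scale norm_triangle_ineq)
qed

section \<open>The spectral subspace of continuous functions is closed\<close>

context compact_haar
begin

lemma integrable_fourier:
  assumes "\<gamma> \<in> dual_group"
  shows "integrable m (\<lambda>x. apply_bcontfun f x * cnj (\<gamma> x))"
  using assms by (intro continuous_integrable continuous_intros) (auto simp: dual_group_def)

text \<open>Every Fourier coefficient is 1-Lipschitz for the sup norm, because characters have
  modulus 1 and the measure has mass 1; the spectral subspace is an intersection of closed
  kernels.\<close>

lemma closed_C_spectral: "closed (C_spectral m \<Lambda>)"
proof -
  have "closed {f :: 'g \<Rightarrow>\<^sub>C complex. fourier m f \<gamma> = 0}" if \<gamma>: "\<gamma> \<in> dual_group" for \<gamma>
  proof -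
    have "dist (fourier m f \<gamma>) (fourier m g \<gamma>) \<le> 1 * dist f g" for f g :: "'g \<Rightarrow>\<^sub>C complex"
    proof -
      have "fourier m f \<gamma> - fourier m g \<gamma> = (LINT x|m. (f x - g x) * cnj (\<gamma> x))"
        using integrable_fourier[OF \<gamma>] by (simp add: fourier_def left_diff_distrib)
      also have "cmod \<dots> \<le> (LINT x|m. cmod ((f x - g x) * cnj (\<gamma> x)))"
        by (rule integral_norm_bound)
      also have "\<dots> \<le> (LINT x|m. dist f g)"
        using integrable_fourier[OF \<gamma>, of "f - g"] \<gamma> dist_bounded[of f _ g]
        by (intro integral_mono integrable_norm)
          (auto simp: norm_mult dual_group_def dist_norm[symmetric])
      finally show ?thesis
        using prob_space by (simp add: dist_norm)
    qed
    then have "continuous_on UNIV (\<lambda>f :: 'g \<Rightarrow>\<^sub>C complex. fourier m f \<gamma>)"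
      by (intro lipschitz_on_continuous_on[of 1] lipschitz_onI) auto
    then have "closed ((\<lambda>f :: 'g \<Rightarrow>\<^sub>C complex. fourier m f \<gamma>) -` {0})"
      by (rule closed_vimage[OF closed_singleton])
    then show ?thesis
      by (simp add: vimage_def)
  qed
  moreover have "C_spectral m \<Lambda> = (\<Inter>\<gamma>\<in>dual_group - \<Lambda>. {f :: 'g \<Rightarrow>\<^sub>C complex. fourier m f \<gamma> = 0})"
    by (auto simp: C_spectral_def)
  ultimately show ?thesis
    by auto
qed

lemma closed_subspace_C_spectral: "closed_subspace (C_spectral m \<Lambda>) C_space"
  unfolding closed_subspace_def
proof
  interpret module complex_field "C_space :: ('g \<Rightarrow>\<^sub>C complex) normed_module"
    using complex_banach_space_C_space
    unfolding complex_banach_space_def complex_normed_space_def by blast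
  show "submodule (C_spectral m \<Lambda>) complex_field C_space"
  proof (rule submoduleI)
    fix f g :: "'g \<Rightarrow>\<^sub>C complex" and c assume fg: "f \<in> C_spectral m \<Lambda>" "g \<in> C_spectral m \<Lambda>"
    show "f \<oplus>\<^bsub>C_space\<^esub> g \<in> C_spectral m \<Lambda>"
      using fg integrable_fourier by (auto simp: C_spectral_def fourier_def distrib_right)
  next
    fix f :: "'g \<Rightarrow>\<^sub>C complex" and c assume f: "f \<in> C_spectral m \<Lambda>"
    then show "c \<odot>\<^bsub>C_space\<^esub> f \<in> C_spectral m \<Lambda>"
      by (auto simp: C_spectral_def fourier_def mult.assoc)
    have "\<ominus>\<^bsub>C_space\<^esub> f = - f"
      using minus_C_space[of 0 f] by (simp add: a_minus_def)
    then show "\<ominus>\<^bsub>C_space\<^esub> f \<in> C_spectral m \<Lambda>"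
      using f by (auto simp: C_spectral_def fourier_def)
  qed (auto simp: C_spectral_def fourier_def)
  show "closedin (Metric_space.mtopology (carrier C_space) (vdist C_space)) (C_spectral m \<Lambda>)"
    using closed_C_spectral by (simp add: vdist_C_space)
qed

end

section \<open>Disjointly supported peaks in spaces without isolated points\<close>

lemma disjoint_open_family:
  fixes U :: "'a::t2_space set"
  assumes perfect: "\<And>a :: 'a. \<not> open {a}" and "open U" "U \<noteq> {}"
  shows "\<exists>V :: nat \<Rightarrow> 'a set. (\<forall>i<n. open (V i) \<and> V i \<noteq> {} \<and> V i \<subseteq> U) \<and>
    (\<forall>i<n. \<forall>j<n. i \<noteq> j \<longrightarrow> V i \<inter> V j = {})"
  using assms(2,3)
proof (induction n arbitrary: U)
  case 0
  then show ?case by simp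
next
  case (Suc n)
  \<comment> \<open>An open singleton being excluded, \<open>U\<close> has two points. Disjoint
    neighbourhoods separate them: one becomes the new member of the family, the other holds the
    family given by induction.\<close>
  then obtain a b where ab: "a \<in> U" "b \<in> U" "a \<noteq> b"
    using perfect by (metis insertI1 is_singletonI' is_singleton_def)
  then obtain A B where AB: "open A" "open B" "a \<in> A" "b \<in> B" "A \<inter> B = {}"
    using hausdorff[OF ab(3)] by blast
  have "open (B \<inter> U)" "B \<inter> U \<noteq> {}"
    using Suc.prems AB ab by auto
  from Suc.IH[OF this] obtain V :: "nat \<Rightarrow> 'a set"
    where V: "\<forall>i<n. open (V i) \<and> V i \<noteq> {} \<and> V i \<subseteq> B \<inter> U"
      "\<forall>i<n. \<forall>j<n. i \<noteq> j \<longrightarrow> V i \<inter> V j = {}"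
    by (elim exE conjE) (rule that)
  have 1: "open ((V(n := A \<inter> U)) i) \<and> (V(n := A \<inter> U)) i \<noteq> {} \<and> (V(n := A \<inter> U)) i \<subseteq> U"
    if "i < Suc n" for i
  proof (cases "i = n")
    case True
    then show ?thesis using Suc.prems AB ab by auto
  next
    case False
    then show ?thesis using V(1) that by auto
  qed
  have 2: "(V(n := A \<inter> U)) i \<inter> (V(n := A \<inter> U)) j = {}" if "i < Suc n" "j < Suc n" "i \<noteq> j" for i j
  proof -
    have "(A \<inter> U) \<inter> V k = {}" if "k < n" for k
      using V(1) that AB(5) by blast
    then show ?thesis
      using V(2) that by (cases "i = n"; cases "j = n") (auto simp: less_Suc_eq)
  qed
  show ?case
    using 1 2 by (intro exI[of _ "V(n := A \<inter> U)"]) blast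
qed

text \<open>The group is left behind here: the remaining argument uses only that there are no
  isolated points, that \<open>Y\<close> is stable under scaling and that \<open>Y\<close>
  approximates peaks at every point and scale.\<close>

locale peak_subspace =
  fixes Y :: "('a::{t2_space} \<Rightarrow>\<^sub>C complex) set"
  assumes perfect: "\<not> open {a :: 'a}"
    and scale: "g \<in> Y \<Longrightarrow> bcontfun_scale c g \<in> Y"
    and peak: "open U \<Longrightarrow> t \<in> U \<Longrightarrow> 0 < e \<Longrightarrow>
      \<exists>q :: 'a \<Rightarrow> real. continuous_on UNIV q \<and> (\<forall>x. 0 \<le> q x \<and> q x \<le> 1) \<and> (\<forall>x. x \<notin> U \<longrightarrow> q x = 0) \<and>
        1 - e \<le> q t \<and> (\<exists>g\<in>Y. \<forall>x. cmod (of_real (q x) - apply_bcontfun g x) \<le> e)"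
begin

lemma localized_peak:
  assumes "open U" "t \<in> U" "0 < e"
  obtains Q g where "\<And>x. apply_bcontfun Q x \<in> \<real>" "\<And>x. 0 \<le> Re (apply_bcontfun Q x)"
    "\<And>x. Re (apply_bcontfun Q x) \<le> 1" "\<And>x. x \<notin> U \<Longrightarrow> apply_bcontfun Q x = 0"
    "1 - e \<le> Re (apply_bcontfun Q t)" "g \<in> Y" "norm (Q - g) \<le> e"
proof -
  obtain q :: "'a \<Rightarrow> real" and g where q: "continuous_on UNIV q" "\<And>x. 0 \<le> q x" "\<And>x. q x \<le> 1"
    "\<And>x. x \<notin> U \<Longrightarrow> q x = 0" "1 - e \<le> q t"
    and g: "g \<in> Y" "\<And>x. cmod (of_real (q x) - apply_bcontfun g x) \<le> e"
    using peak[OF assms] by blast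
  have "(\<lambda>x. complex_of_real (q x)) \<in> bcontfun"
    using q by (intro bcontfun_normI[of _ 1] continuous_intros) auto
  then have Q: "apply_bcontfun (Bcontfun (\<lambda>x. complex_of_real (q x))) x = of_real (q x)" for x
    by (simp add: Bcontfun_inverse)
  have "norm (Bcontfun (\<lambda>x. complex_of_real (q x)) - g) \<le> e"
    using g(2) by (intro norm_bound) (simp add: Q)
  then show thesis
    using q g by (intro that[of "Bcontfun (\<lambda>x. complex_of_real (q x))" g]) (simp_all add: Q)
qed

text \<open>
  Combinations of disjointly supported peaks with coefficients of modulus 1 have norm at most 1, so
  the values of \<open>\<phi>\<close> on the peaks are summable with sum at most \<open>K\<close>.
\<close>

lemma localized_peak_null:
  fixes \<phi> :: "('a \<Rightarrow>\<^sub>C complex) \<Rightarrow> complex"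
  assumes add: "\<And>f g. \<phi> (f + g) = \<phi> f + \<phi> g"
    and scl: "\<And>c f. \<phi> (bcontfun_scale c f) = c * \<phi> f"
    and bdd: "\<And>f. cmod (\<phi> f) \<le> K * norm f"
    and U: "open U" "U \<noteq> {}" and e: "0 < e"
  obtains Q g t where "t \<in> U" "\<And>x. apply_bcontfun Q x \<in> \<real>" "\<And>x. 0 \<le> Re (apply_bcontfun Q x)"
    "\<And>x. Re (apply_bcontfun Q x) \<le> 1" "\<And>x. x \<notin> U \<Longrightarrow> apply_bcontfun Q x = 0"
    "1 - e \<le> Re (apply_bcontfun Q t)" "g \<in> Y" "norm (Q - g) \<le> e" "cmod (\<phi> Q) \<le> e"
proof -
  \<comment> \<open>If all of \<open>n\<close> peaks had \<open>\<phi>\<close>-values above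
    \<open>e\<close>, these would sum to more than \<open>K\<close>.\<close>
  obtain n :: nat where n: "K / e < n"
    using reals_Archimedean2 by blast
  from disjoint_open_family[OF perfect U, where n = n] obtain V :: "nat \<Rightarrow> 'a set"
    where V': "\<forall>i<n. open (V i) \<and> V i \<noteq> {} \<and> V i \<subseteq> U"
      "\<forall>i<n. \<forall>j<n. i \<noteq> j \<longrightarrow> V i \<inter> V j = {}"
    by (elim exE conjE) (rule that)
  then have V: "\<And>i. i < n \<Longrightarrow> open (V i)" "\<And>i. i < n \<Longrightarrow> V i \<noteq> {}" "\<And>i. i < n \<Longrightarrow> V i \<subseteq> U"
    "\<And>i j. i < n \<Longrightarrow> j < n \<Longrightarrow> i \<noteq> j \<Longrightarrow> V i \<inter> V j = {}"
    by simp_all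
  define P where "P = (\<lambda>i t Q g. t \<in> V i \<and> (\<forall>x. apply_bcontfun Q x \<in> \<real>) \<and>
    (\<forall>x. 0 \<le> Re (apply_bcontfun Q x)) \<and> (\<forall>x. Re (apply_bcontfun Q x) \<le> 1) \<and>
    (\<forall>x. x \<notin> V i \<longrightarrow> apply_bcontfun Q x = 0) \<and> 1 - e \<le> Re (apply_bcontfun Q t) \<and> g \<in> Y \<and>
    norm (Q - g) \<le> e)"
  have "\<exists>t Q g. P i t Q g" if i: "i < n" for i
  proof -
    obtain t where "t \<in> V i"
      using V(2)[OF i] by blast
    then show ?thesis
      unfolding P_def using localized_peak[OF V(1)[OF i] \<open>t \<in> V i\<close> e] by metis
  qed
  then obtain t Q g where P: "\<And>i. i < n \<Longrightarrow> P i (t i) (Q i) (g i)"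
    by metis
  have \<phi>0: "\<phi> 0 = 0"
    using add[of 0 0] by simp
  have \<phi>sum: "\<phi> (\<Sum>i<k. F i) = (\<Sum>i<k. \<phi> (F i))" for F and k :: nat
    by (induction k) (simp_all add: \<phi>0 add)
  \<comment> \<open>Rotates \<open>\<phi> (Q i)\<close> onto its modulus. Where
    \<open>\<phi> (Q i) = 0\<close> the sign is 0, hence only
    \<open>cmod (c i) \<le> 1\<close>.\<close>
  define c where "c = (\<lambda>i. cnj (sgn (\<phi> (Q i))))"
  have c1: "cmod (c i) \<le> 1" for i
    by (simp add: c_def norm_sgn)
  have c2: "c i * \<phi> (Q i) = of_real (cmod (\<phi> (Q i)))" for i
    by (simp add: c_def sgn_eq complex_norm_square[symmetric] power2_eq_square mult.commute)
  define F where "F = (\<Sum>i<n. bcontfun_scale (c i) (Q i))"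
  have "apply_bcontfun (\<Sum>i<k. bcontfun_scale (c i) (Q i)) x = (\<Sum>i<k. c i * apply_bcontfun (Q i) x)" for k x
    by (induction k) simp_all
  then have F: "apply_bcontfun F x = (\<Sum>i<n. c i * apply_bcontfun (Q i) x)" for x
    by (simp add: F_def)
  have "norm F \<le> 1"
  proof (rule norm_bound)
    fix x
    show "cmod (apply_bcontfun F x) \<le> 1"
    proof (cases "\<exists>j<n. x \<in> V j")
      case True
      then obtain j where j: "j < n" "x \<in> V j" by blast
      have "c i * apply_bcontfun (Q i) x = 0" if "i \<in> {..<n} - {j}" for i
      proof -
        have "x \<notin> V i"
          using V(4)[of i j] j that by auto
        then show ?thesis
          using P[of i] that by (simp add: P_def)
      qed
      then have "(\<Sum>i\<in>{..<n} - {j}. c i * apply_bcontfun (Q i) x) = 0"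
        by (intro sum.neutral ballI)
      then have "apply_bcontfun F x = c j * apply_bcontfun (Q j) x"
        using j(1) by (simp add: F sum.remove[of "{..<n}" j])
      moreover have "cmod (apply_bcontfun (Q j) x) \<le> 1"
        using P[OF j(1)] by (auto simp: P_def in_Reals_norm complex_is_Real_iff cmod_eq_Re)
      ultimately show ?thesis
        using c1[of j] by (simp add: norm_mult mult_le_one)
    next
      case False
      then have "apply_bcontfun F x = 0"
        using P by (simp add: F P_def)
      then show ?thesis by simp
    qed
  qed
  have "1 \<le> norm (const_bcontfun 1 :: 'a \<Rightarrow>\<^sub>C complex)"
    using norm_bounded[of "const_bcontfun 1 :: 'a \<Rightarrow>\<^sub>C complex"] by (simp add: const_bcontfun.rep_eq)
  then have K: "0 \<le> K"
    using order_trans[OF norm_ge_zero bdd[of "const_bcontfun 1"]] by (auto simp: zero_le_mult_iff)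
  have "(\<Sum>i<n. cmod (\<phi> (Q i))) = cmod (\<phi> F)"
  proof -
    have "\<phi> F = of_real (\<Sum>i<n. cmod (\<phi> (Q i)))"
      by (simp add: F_def \<phi>sum scl c2)
    then show ?thesis
      by (simp add: sum_nonneg del: of_real_sum)
  qed
  also have "\<dots> \<le> K"
    using order_trans[OF bdd[of F] mult_left_mono[OF \<open>norm F \<le> 1\<close> K]] by simp
  finally have sum: "(\<Sum>i<n. cmod (\<phi> (Q i))) \<le> K" .
  have "\<exists>i<n. cmod (\<phi> (Q i)) \<le> e"
  proof (rule ccontr)
    assume "\<not> (\<exists>i<n. cmod (\<phi> (Q i)) \<le> e)"
    then have "(\<Sum>i<n. e) \<le> (\<Sum>i<n. cmod (\<phi> (Q i)))"
      by (intro sum_mono) auto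
    then have "real n * e \<le> K"
      using sum by simp
    then show False
      using n e by (simp add: field_simps)
  qed
  then obtain i where i: "i < n" "cmod (\<phi> (Q i)) \<le> e" by blast
  show thesis
    using P[OF i(1)] i(2) V(3)[OF i(1)] unfolding P_def
    by (intro that[of "t i" "Q i" "g i"]) auto
qed

end

section \<open>Narrowness from peaks\<close>

context peak_subspace
begin

text \<open>On \<open>U\<close>, up to a small error, \<open>z\<close> is a convex combination of
  the constants \<open>\<eta>\<close> and \<open>\<xi>\<close> with weight \<open>q\<close>, so its
  norm barely exceeds 1; at \<open>t\<close> the weight is almost 1 and \<open>z\<close> nearly
  agrees with \<open>x\<close>. As \<open>y - z\<close> is a multiple of a single peak, it is close
  to \<open>Y\<close> and \<open>\<phi>\<close> is small on it.\<close>

lemma localized_correction: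
  fixes \<phi> :: "('a \<Rightarrow>\<^sub>C complex) \<Rightarrow> complex"
  assumes add: "\<And>f g. \<phi> (f + g) = \<phi> f + \<phi> g"
    and scl: "\<And>c f. \<phi> (bcontfun_scale c f) = c * \<phi> f"
    and bdd: "\<And>f. cmod (\<phi> f) \<le> K * norm f"
    and x: "norm x = 1" and y: "norm y \<le> 1" and e: "0 < e"
  obtains z w t where "norm z \<le> 1 + e" "w \<in> Y" "norm (y - z - w) \<le> e" "cmod (\<phi> (y - z)) \<le> e"
    "cmod (apply_bcontfun z t - apply_bcontfun x t) \<le> e" "1 - e \<le> cmod (apply_bcontfun x t)"
proof -
  \<comment> \<open>The costliest estimate is at \<open>t\<close>: the oscillations of
    \<open>y\<close> and \<open>x\<close> cost \<open>d\<close> each, and the defect of the peak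
    \<open>2 * d\<close>, as \<open>cmod (\<xi> - \<eta>) \<le> 2\<close>.\<close>
  define d where "d = e / 4"
  have d: "0 < d" "4 * d = e"
    using e by (simp_all add: d_def)
  have "\<exists>s. 1 - d < cmod (apply_bcontfun x s)"
  proof (rule ccontr)
    assume "\<not> (\<exists>s. 1 - d < cmod (apply_bcontfun x s))"
    then have "norm x \<le> 1 - d"
      by (intro norm_bound) (simp add: not_less)
    then show False using x d by simp
  qed
  then obtain s where s: "1 - d < cmod (apply_bcontfun x s)" ..
  define \<xi> \<eta> where "\<xi> = apply_bcontfun x s" and "\<eta> = apply_bcontfun y s"
  have \<xi>\<eta>: "cmod \<xi> \<le> 1" "cmod \<eta> \<le> 1"
    using norm_bounded[of x s] norm_bounded[of y s] x y by (simp_all add: \<xi>_def \<eta>_def)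
  then have \<xi>\<eta>2: "cmod (\<xi> - \<eta>) \<le> 2"
    using norm_triangle_ineq4[of \<xi> \<eta>] by linarith
  define U where "U = {t. dist (apply_bcontfun x t) \<xi> < d} \<inter> {t. dist (apply_bcontfun y t) \<eta> < d}"
  have "open U"
    unfolding U_def by (intro open_Int open_Collect_less continuous_intros) auto
  moreover have "s \<in> U"
    using d by (simp add: U_def \<xi>_def \<eta>_def)
  ultimately have U: "open U" "U \<noteq> {}"
    by auto
  obtain Q g t where Q: "t \<in> U" "\<And>x. apply_bcontfun Q x \<in> \<real>" "\<And>x. 0 \<le> Re (apply_bcontfun Q x)"
    "\<And>x. Re (apply_bcontfun Q x) \<le> 1" "\<And>x. x \<notin> U \<Longrightarrow> apply_bcontfun Q x = 0"
    "1 - d \<le> Re (apply_bcontfun Q t)" and g: "g \<in> Y" "norm (Q - g) \<le> d" and \<phi>Q: "cmod (\<phi> Q) \<le> d"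
    by (rule localized_peak_null[OF add scl bdd U d(1)]) (rule that)
  define q where "q = (\<lambda>x. Re (apply_bcontfun Q x))"
  have q: "0 \<le> q x" "q x \<le> 1" "apply_bcontfun Q x = of_real (q x)" "x \<notin> U \<Longrightarrow> q x = 0" for x
    using Q by (simp_all add: q_def)
  have qt: "1 - d \<le> q t"
    using Q by (simp add: q_def)
  define z where "z = y + bcontfun_scale (\<xi> - \<eta>) Q"
  define w where "w = bcontfun_scale (\<eta> - \<xi>) g"
  have z: "apply_bcontfun z r = apply_bcontfun y r + (\<xi> - \<eta>) * of_real (q r)" for r
    by (simp add: z_def q)
  show thesis
  proof (rule that[of z w t])
    show "norm z \<le> 1 + e"
    proof (rule norm_bound)
      fix r
      show "cmod (apply_bcontfun z r) \<le> 1 + e"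
      proof (cases "r \<in> U")
        case True
        \<comment> \<open>Splits off the convex combination; the rest is the oscillation of
          \<open>y\<close> on \<open>U\<close>.\<close>
        have "apply_bcontfun z r
            = (apply_bcontfun y r - \<eta>) + (of_real (1 - q r) * \<eta> + of_real (q r) * \<xi>)"
          by (simp add: z algebra_simps)
        also have "cmod \<dots> \<le> cmod (apply_bcontfun y r - \<eta>)
            + (cmod (of_real (1 - q r) * \<eta>) + cmod (of_real (q r) * \<xi>))"
          by (intro order_trans[OF norm_triangle_ineq] add_left_mono norm_triangle_ineq)
        also have "\<dots> \<le> d + ((1 - q r) * 1 + q r * 1)"
          using True q[of r] \<xi>\<eta> unfolding norm_mult norm_of_real
          by (intro add_mono mult_mono) (auto simp: U_def dist_norm)
        finally show ?thesis
          using d by simp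
      next
        case False
        then have "apply_bcontfun z r = apply_bcontfun y r"
          by (simp add: z q)
        then show ?thesis
          using norm_bounded[of y r] y e by simp
      qed
    qed
    show "w \<in> Y"
      unfolding w_def by (rule scale[OF g(1)])
    have "y - z - w = bcontfun_scale (\<eta> - \<xi>) (Q - g)"
      by (intro bcontfun_eqI) (simp add: z_def w_def algebra_simps)
    then have "norm (y - z - w) = cmod (\<xi> - \<eta>) * norm (Q - g)"
      by (simp add: norm_bcontfun_scale norm_minus_commute)
    also have "\<dots> \<le> 2 * d"
      using \<xi>\<eta>2 g by (intro mult_mono) auto
    finally show "norm (y - z - w) \<le> e"
      using d by simp
    have "y - z = bcontfun_scale (\<eta> - \<xi>) Q"
      by (intro bcontfun_eqI) (simp add: z_def algebra_simps)
    then have "cmod (\<phi> (y - z)) = cmod (\<xi> - \<eta>) * cmod (\<phi> Q)"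
      by (simp add: scl norm_mult norm_minus_commute)
    also have "\<dots> \<le> 2 * d"
      using \<xi>\<eta>2 \<phi>Q by (intro mult_mono) auto
    finally show "cmod (\<phi> (y - z)) \<le> e"
      using d by simp
    have "apply_bcontfun z t - apply_bcontfun x t
        = (apply_bcontfun y t - \<eta>) + ((\<xi> - apply_bcontfun x t) - (\<xi> - \<eta>) * of_real (1 - q t))"
      by (simp add: z algebra_simps)
    also have "cmod \<dots> \<le> cmod (apply_bcontfun y t - \<eta>)
        + (cmod (\<xi> - apply_bcontfun x t) + cmod ((\<xi> - \<eta>) * of_real (1 - q t)))"
      by (intro order_trans[OF norm_triangle_ineq] add_left_mono norm_triangle_ineq4)
    also have "\<dots> \<le> d + (d + 2 * d)"
    proof -
      have "cmod ((\<xi> - \<eta>) * of_real (1 - q t)) \<le> 2 * d"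
        using \<xi>\<eta>2 q(2)[of t] qt unfolding norm_mult norm_of_real by (intro mult_mono) auto
      then show ?thesis
        using Q(1) by (intro add_mono) (auto simp: U_def dist_norm norm_minus_commute)
    qed
    finally show "cmod (apply_bcontfun z t - apply_bcontfun x t) \<le> e"
      using d by simp
    have "cmod \<xi> - cmod (apply_bcontfun x t) < d"
      using Q(1) norm_triangle_ineq2[of \<xi> "apply_bcontfun x t"]
      by (auto simp: U_def dist_norm norm_minus_commute)
    then show "1 - e \<le> cmod (apply_bcontfun x t)"
      using s d by (simp add: \<xi>_def)
  qed
qed

text \<open>Normalising the vector of \<open>localized_correction\<close> moves it by at most
  \<open>2 * d\<close>. Since it nearly agrees with \<open>x\<close> at a point where
  \<open>x\<close> has modulus almost 1, the sum has norm almost 2.\<close>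

lemma unit_sphere_correction:
  fixes \<phi> :: "('a \<Rightarrow>\<^sub>C complex) \<Rightarrow> complex"
  assumes add: "\<And>f g. \<phi> (f + g) = \<phi> f + \<phi> g"
    and scl: "\<And>c f. \<phi> (bcontfun_scale c f) = c * \<phi> f"
    and bdd: "\<And>f. cmod (\<phi> f) \<le> K * norm f"
    and x: "norm x = 1" and y: "norm y = 1" and e: "0 < e"
  obtains z w where "norm z = 1" "w \<in> Y" "norm (y - z - w) + cmod (\<phi> (y - z)) \<le> e"
    "2 - e \<le> norm (x + z)"
proof -
  have K: "0 \<le> K"
    using order_trans[OF norm_ge_zero bdd[of x]] x by simp
  \<comment> \<open>The first estimate needs \<open>(2 * K + 4) * d\<close>, the second
    \<open>5 * d\<close>; the bound \<open>1/4\<close> keeps \<open>z\<close> away from 0 for the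
    normalisation.\<close>
  define d where "d = min (1/4) (e / (2 * K + 5))"
  have d: "0 < d" "d \<le> 1/4" "d \<le> e / (2 * K + 5)"
    using e K unfolding d_def by (simp_all only: min.cobounded1 min.cobounded2) simp
  then have de: "(2 * K + 5) * d \<le> e"
    using K by (simp add: pos_le_divide_eq mult.commute)
  have Kd: "0 \<le> K * d"
    using K d by simp
  obtain z w t where z: "norm z \<le> 1 + d" and w: "w \<in> Y" "norm (y - z - w) \<le> d"
    and \<phi>: "cmod (\<phi> (y - z)) \<le> d"
    and t: "cmod (apply_bcontfun z t - apply_bcontfun x t) \<le> d" "1 - d \<le> cmod (apply_bcontfun x t)"
    by (rule localized_correction[OF add scl bdd x eq_refl[OF y] d(1)]) (rule that)
  have "cmod (apply_bcontfun x t) - cmod (apply_bcontfun z t) \<le> d"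
    using norm_triangle_ineq2[of "apply_bcontfun x t" "apply_bcontfun z t"] t(1)
    by (simp add: norm_minus_commute)
  then have z2: "1 - 2 * d \<le> norm z"
    using t(2) norm_bounded[of z t] by linarith
  then have zpos: "0 < norm z"
    using d by linarith
  define v where "v = bcontfun_scale (of_real (1 / norm z)) z"
  have v1: "norm v = 1"
    using zpos by (simp add: v_def norm_bcontfun_scale norm_divide)
  have "z - v = bcontfun_scale (of_real (1 - 1 / norm z)) z"
    by (intro bcontfun_eqI) (simp add: v_def algebra_simps)
  then have "norm (z - v) = \<bar>1 - 1 / norm z\<bar> * norm z"
    by (simp only: norm_bcontfun_scale norm_of_real)
  also have "\<dots> = \<bar>norm z - 1\<bar>"
    using zpos by (simp add: abs_mult_pos left_diff_distrib)
  finally have zv: "norm (z - v) \<le> 2 * d"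
    using z z2 d by simp
  show thesis
  proof (rule that[OF v1 w(1)])
    have "norm (y - v - w) = norm ((y - z - w) + (z - v))"
      by (simp add: algebra_simps)
    also have "\<dots> \<le> norm (y - z - w) + norm (z - v)"
      by (rule norm_triangle_ineq)
    finally have 1: "norm (y - v - w) \<le> d + 2 * d"
      using w(2) zv by linarith
    have "\<phi> (y - v) = \<phi> (y - z) + \<phi> (z - v)"
      using add[of "y - z" "z - v"] by simp
    then have "cmod (\<phi> (y - v)) \<le> d + K * norm (z - v)"
      using norm_triangle_ineq[of "\<phi> (y - z)" "\<phi> (z - v)"] \<phi> bdd[of "z - v"] by simp
    also have "\<dots> \<le> d + K * (2 * d)"
      using K zv by (intro add_left_mono mult_left_mono)
    finally show "norm (y - v - w) + cmod (\<phi> (y - v)) \<le> e"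
      using 1 d(1) de by (simp add: algebra_simps)
    have "2 * cmod (apply_bcontfun x t) \<le> cmod (apply_bcontfun x t + apply_bcontfun z t)
        + cmod (apply_bcontfun z t - apply_bcontfun x t)"
      using norm_triangle_ineq4[of "apply_bcontfun x t + apply_bcontfun z t"
          "apply_bcontfun z t - apply_bcontfun x t"] by (simp add: norm_mult flip: mult_2)
    moreover have "cmod (apply_bcontfun x t + apply_bcontfun z t) \<le> norm (x + z)"
      using norm_bounded[of "x + z" t] by simp
    moreover have "norm (x + z) \<le> norm (x + v) + norm (z - v)"
      using norm_triangle_ineq[of "x + v" "z - v"] by simp
    ultimately have "2 - 5 * d \<le> norm (x + v)"
      using t zv by simp
    then show "2 - e \<le> norm (x + v)"
      using de Kd by (simp add: algebra_simps)
  qed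
qed

section \<open>Rank-one operators and the Daugavet property\<close>

lemma bounded_operator_functional:
  fixes T :: "('a \<Rightarrow>\<^sub>C complex) \<Rightarrow> ('a \<Rightarrow>\<^sub>C complex)"
  assumes T: "bounded_operator C_space C_space T" and rank: "rank_one C_space C_space T"
  obtains \<phi> u K where "norm u = 1" "\<And>f. T f = bcontfun_scale (\<phi> f) u"
    "\<And>f g. \<phi> (f + g) = \<phi> f + \<phi> g" "\<And>c f. \<phi> (bcontfun_scale c f) = c * \<phi> f"
    "\<And>f. cmod (\<phi> f) \<le> K * norm f"
proof -
  obtain u0 :: "'a \<Rightarrow>\<^sub>C complex" where u0: "u0 \<noteq> 0" "range T = range (\<lambda>c. bcontfun_scale c u0)"
    using rank by (auto simp: rank_one_def)
  obtain K where K: "\<And>f. norm (T f) \<le> K * norm f"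
    and Tadd: "\<And>f g. T (f + g) = T f + T g"
    and Tscl: "\<And>c f. T (bcontfun_scale c f) = bcontfun_scale c (T f)"
    using T by (auto simp: bounded_operator_def)
  \<comment> \<open>With \<open>u\<close> of norm 1, the norm of \<open>T f\<close> is
    \<open>cmod (\<phi> f)\<close>.\<close>
  define u where "u = bcontfun_scale (of_real (1 / norm u0)) u0"
  have u: "norm u = 1"
    using u0(1) by (simp add: u_def norm_bcontfun_scale norm_divide)
  have "\<exists>c. T f = bcontfun_scale c u" for f
  proof -
    obtain c where "T f = bcontfun_scale c u0"
      using u0(2) by blast
    then have "T f = bcontfun_scale (c * of_real (norm u0)) u"
      using u0(1) by (intro bcontfun_eqI) (simp add: u_def)
    then show ?thesis ..
  qed
  then obtain \<phi> where \<phi>: "\<And>f. T f = bcontfun_scale (\<phi> f) u"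
    by metis
  \<comment> \<open>Since \<open>u\<close> is not zero, scalars can be compared after multiplication
    with \<open>u\<close>; this carries linearity from \<open>T\<close> over to the pointwise chosen
    \<open>\<phi>\<close>.\<close>
  have inj: "a = b" if "bcontfun_scale a u = bcontfun_scale b u" for a b
  proof -
    have "bcontfun_scale (a - b) u = bcontfun_scale a u - bcontfun_scale b u"
      by (intro bcontfun_eqI) (simp add: left_diff_distrib)
    then have "norm (bcontfun_scale (a - b) u) = 0"
      using that by simp
    then show ?thesis
      using u by (simp add: norm_bcontfun_scale)
  qed
  show thesis
  proof (rule that[OF u \<phi>])
    show "\<phi> (f + g) = \<phi> f + \<phi> g" for f g
    proof (rule inj)
      have "bcontfun_scale (\<phi> (f + g)) u = T f + T g"
        by (simp only: \<phi>[symmetric] Tadd)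
      also have "\<dots> = bcontfun_scale (\<phi> f + \<phi> g) u"
        by (intro bcontfun_eqI) (simp add: \<phi> distrib_right)
      finally show "bcontfun_scale (\<phi> (f + g)) u = bcontfun_scale (\<phi> f + \<phi> g) u" .
    qed
    show "\<phi> (bcontfun_scale c f) = c * \<phi> f" for c f
    proof (rule inj)
      have "bcontfun_scale (\<phi> (bcontfun_scale c f)) u = bcontfun_scale c (T f)"
        by (simp only: \<phi>[symmetric] Tscl)
      also have "\<dots> = bcontfun_scale (c * \<phi> f) u"
        by (intro bcontfun_eqI) (simp add: \<phi>)
      finally show "bcontfun_scale (\<phi> (bcontfun_scale c f)) u = bcontfun_scale (c * \<phi> f) u" .
    qed
    show "cmod (\<phi> f) \<le> K * norm f" for f
      using K[of f] by (simp add: \<phi> norm_bcontfun_scale u)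
  qed
qed

text \<open>Only the lower bound needs work. A vector of the ball at which \<open>\<phi>\<close> is
  real and nearly maximal is corrected to agree with \<open>u\<close> at a point \<open>t\<close>
  where \<open>u\<close> has modulus almost 1, with \<open>\<phi>\<close> almost unchanged; there
  \<open>z + T z\<close> is nearly \<open>(1 + S) * u\<close>.\<close>

lemma daugavet_property_C_space:
  "daugavet_property (C_space :: ('a \<Rightarrow>\<^sub>C complex) normed_module)"
  unfolding daugavet_property_def
proof (intro conjI allI impI complex_banach_space_C_space)
  fix T :: "('a \<Rightarrow>\<^sub>C complex) \<Rightarrow> ('a \<Rightarrow>\<^sub>C complex)"
  assume "bounded_operator C_space C_space T" "rank_one C_space C_space T"
  then obtain \<phi> u K where u: "norm u = 1" and T: "\<And>f. T f = bcontfun_scale (\<phi> f) u"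
    and add: "\<And>f g. \<phi> (f + g) = \<phi> f + \<phi> g" and scl: "\<And>c f. \<phi> (bcontfun_scale c f) = c * \<phi> f"
    and bdd: "\<And>f. cmod (\<phi> f) \<le> K * norm f"
    by (rule bounded_operator_functional) (rule that)
  define B :: "('a \<Rightarrow>\<^sub>C complex) set" where "B = {f. norm f \<le> 1}"
  define S where "S = (SUP f\<in>B. cmod (\<phi> f))"
  define N where "N = (SUP f\<in>B. norm (f + T f))"
  have K: "0 \<le> K"
    using order_trans[OF norm_ge_zero bdd[of u]] u by simp
  have B0: "B \<noteq> {}"
    by (auto simp: B_def intro: exI[of _ 0])
  have \<phi>B: "cmod (\<phi> f) \<le> K" if "f \<in> B" for f
    using order_trans[OF bdd[of f], of K] that K mult_left_mono[of "norm f" 1 K] by (simp add: B_def)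
  then have bS: "bdd_above ((\<lambda>f. cmod (\<phi> f)) ` B)"
    by (auto simp: bdd_above_def)
  have S: "cmod (\<phi> f) \<le> S" if "f \<in> B" for f
    unfolding S_def using that bS by (rule cSUP_upper)
  have NS: "norm (f + T f) \<le> 1 + S" if "f \<in> B" for f
  proof -
    have "norm (f + T f) \<le> norm f + cmod (\<phi> f)"
      using norm_triangle_ineq[of f "T f"] by (simp add: T norm_bcontfun_scale u)
    then show ?thesis
      using S[OF that] that by (simp add: B_def)
  qed
  then have bN: "bdd_above ((\<lambda>f. norm (f + T f)) ` B)"
    by (auto simp: bdd_above_def)
  have N: "norm (f + T f) \<le> N" if "f \<in> B" for f
    unfolding N_def using that bN by (rule cSUP_upper)
  have "N \<le> 1 + S"
    unfolding N_def using B0 NS by (rule cSUP_least)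
  moreover have "1 + S \<le> N"
  proof (rule tendsto_le)
    show "((\<lambda>e. (1 + S - e) * (1 - e) - 2 * e) \<longlongrightarrow> 1 + S) (at_right 0)"
      by (auto intro!: tendsto_eq_intros)
    show "((\<lambda>e. N * (1 + e)) \<longlongrightarrow> N) (at_right 0)"
      by (auto intro!: tendsto_eq_intros)
    \<comment> \<open>The factor \<open>1 + S - e\<close> comes from the near-maximal
      \<open>y0\<close>, \<open>1 - e\<close> from \<open>u\<close> at \<open>t\<close>, and
      \<open>1 + e\<close> from the norm of \<open>z\<close>; the two subtracted \<open>e\<close>
      account for \<open>z - u\<close> at \<open>t\<close> and for
      \<open>\<phi> (y - z)\<close>.\<close>
    have "(1 + S - e) * (1 - e) - 2 * e \<le> N * (1 + e)" if e: "0 < e" "e < 1" for e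
    proof -
      obtain y0 where y0: "y0 \<in> B" "S - e < cmod (\<phi> y0)"
        using less_cSUP_iff[OF B0 bS, of "S - e"] e by (auto simp: S_def)
      define y where "y = bcontfun_scale (cnj (sgn (\<phi> y0))) y0"
      have "norm y \<le> 1"
        using y0(1) by (simp add: y_def norm_bcontfun_scale norm_sgn B_def)
      moreover define a where "a = cmod (\<phi> y0)"
      have \<phi>y: "\<phi> y = of_real a"
        by (simp add: y_def a_def scl sgn_eq complex_norm_square[symmetric] power2_eq_square mult.commute)
      ultimately obtain z t where z: "norm z \<le> 1 + e" and \<phi>z: "cmod (\<phi> (y - z)) \<le> e"
        and t: "cmod (apply_bcontfun z t - apply_bcontfun u t) \<le> e" "1 - e \<le> cmod (apply_bcontfun u t)"
        using localized_correction[OF add scl bdd u _ e(1), of y] by metis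
      have ut: "cmod (apply_bcontfun u t) \<le> 1"
        using norm_bounded[of u t] u by simp
      have "\<phi> y = \<phi> (y - z) + \<phi> z"
        using add[of "y - z" z] by simp
      then have \<phi>za: "of_real a - \<phi> z = \<phi> (y - z)"
        by (simp add: \<phi>y)
      have "(1 + of_real a) * apply_bcontfun u t = (apply_bcontfun (z + T z) t
          - (apply_bcontfun z t - apply_bcontfun u t)) + (of_real a - \<phi> z) * apply_bcontfun u t"
        by (simp add: T algebra_simps)
      then have "cmod ((1 + of_real a) * apply_bcontfun u t) \<le> (cmod (apply_bcontfun (z + T z) t)
          + cmod (apply_bcontfun z t - apply_bcontfun u t)) + cmod ((of_real a - \<phi> z) * apply_bcontfun u t)"
        by (metis order_trans[OF norm_triangle_ineq] add_right_mono norm_triangle_ineq4)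
      moreover have "cmod ((1 + of_real a) * apply_bcontfun u t) = (1 + a) * cmod (apply_bcontfun u t)"
        using norm_of_real[of "1 + a", where ?'a = complex] by (simp add: norm_mult a_def)
      moreover have "cmod ((of_real a - \<phi> z) * apply_bcontfun u t) \<le> e * 1"
        unfolding \<phi>za norm_mult using \<phi>z ut e by (intro mult_mono) auto
      moreover have "cmod (apply_bcontfun (z + T z) t) \<le> norm (z + T z)"
        by (rule norm_bounded)
      moreover have "norm (z + T z) \<le> N * (1 + e)"
      proof -
        let ?f = "bcontfun_scale (of_real (1 / (1 + e))) z"
        have "norm ?f = \<bar>1 / (1 + e)\<bar> * norm z"
          by (simp only: norm_bcontfun_scale norm_of_real)
        then have "?f \<in> B"
          using z e by (simp add: B_def pos_divide_le_eq)
        moreover have "?f + T ?f = bcontfun_scale (of_real (1 / (1 + e))) (z + T z)"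
          by (intro bcontfun_eqI) (simp add: T scl algebra_simps)
        then have "norm (?f + T ?f) = \<bar>1 / (1 + e)\<bar> * norm (z + T z)"
          by (simp only: norm_bcontfun_scale norm_of_real)
        ultimately have "norm (z + T z) / (1 + e) \<le> N"
          using N[of ?f] e by simp
        then show ?thesis
          using e by (simp add: pos_divide_le_eq)
      qed
      moreover have "(1 + S - e) * (1 - e) \<le> (1 + a) * cmod (apply_bcontfun u t)"
        using y0(2) t(2) e by (intro mult_mono) (auto simp: a_def)
      ultimately show ?thesis
        using t(1) by linarith
    qed
    then show "\<forall>\<^sub>F e in at_right 0. (1 + S - e) * (1 - e) - 2 * e \<le> N * (1 + e)"
      by (intro eventually_at_rightI[of 0 1]) auto
  qed simp
  ultimately have "N = 1 + S"
    by simp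
  then show "operator_norm C_space C_space (\<lambda>x. x \<oplus>\<^bsub>C_space\<^esub> T x) = 1 + operator_norm C_space C_space T"
    by (simp add: operator_norm_def N_def S_def B_def T norm_bcontfun_scale u)
qed

lemma rich_C_space:
  assumes closed: "closed_subspace Y C_space"
  shows "rich C_space Y"
proof -
  interpret complex_banach_space "C_space :: ('a \<Rightarrow>\<^sub>C complex) normed_module"
    by (rule complex_banach_space_C_space)
  interpret normed_quotient "C_space :: ('a \<Rightarrow>\<^sub>C complex) normed_module" Y
    by unfold_locales (rule closed)
  \<comment> \<open>The quotient norm is an infimum over sums with elements of \<open>Y\<close>, so
    \<open>- w\<close> is the competitor for \<open>y - z - w\<close>.\<close>
  have uminus: "- w \<in> Y" if "w \<in> Y" for w
  proof -
    have "- w = bcontfun_scale (- 1) w"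
      by (intro bcontfun_eqI) simp
    then show ?thesis
      using scale[OF that] by simp
  qed
  have "narrow C_space Q proj"
    unfolding narrow_def
  proof (intro conjI ballI allI impI)
    show "daugavet_property (C_space :: ('a \<Rightarrow>\<^sub>C complex) normed_module)"
      by (rule daugavet_property_C_space)
    show "complex_banach_space Q"
      by (rule complex_banach_space_quotient[OF complex_banach_space_C_space closed])
    show "bounded_operator C_space Q proj"
      by (rule bounded_operator_proj)
    fix x y :: "'a \<Rightarrow>\<^sub>C complex" and \<phi> :: "('a \<Rightarrow>\<^sub>C complex) \<Rightarrow> complex" and e :: real
    assume x: "x \<in> unit_sphere C_space" and y: "y \<in> unit_sphere C_space"
      and \<phi>: "\<phi> \<in> dual_space C_space" and e: "0 < e"
    obtain K where add: "\<And>f g. \<phi> (f + g) = \<phi> f + \<phi> g"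
      and scl: "\<And>c f. \<phi> (bcontfun_scale c f) = c * \<phi> f" and bdd: "\<And>f. cmod (\<phi> f) \<le> K * norm f"
      using \<phi> by (auto simp: dual_space_def bounded_operator_def complex_scalars_def)
    have "norm x = 1" "norm y = 1"
      using x y by (simp_all add: unit_sphere_def)
    then obtain z w where z: "norm z = 1" and w: "w \<in> Y"
      and yz: "norm (y - z - w) + cmod (\<phi> (y - z)) \<le> e" and xz: "2 - e \<le> norm (x + z)"
      by (rule unit_sphere_correction[OF add scl bdd _ _ e]) (rule that)
    have "vnorm Q (proj (y - z)) \<le> norm (- w + (y - z))"
      using vnorm_quotient_le[OF uminus[OF w], of "y - z"] by simp
    then show "\<exists>z\<in>unit_sphere C_space.
        vnorm Q (proj (y \<ominus>\<^bsub>C_space\<^esub> z)) + cmod (\<phi> (y \<ominus>\<^bsub>C_space\<^esub> z)) \<le> e \<and>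
        2 - e \<le> vnorm C_space (x \<oplus>\<^bsub>C_space\<^esub> z)"
      using yz xz z by (intro bexI[of _ z]) (auto simp: unit_sphere_def algebra_simps)
  qed
  then show ?thesis
    using closed by (simp add: rich_def)
qed

end

text \<open>By translation, one isolated point would make all points isolated, and a compact
  discrete space is finite.\<close>

lemma infinite_compact_group_perfect:
  fixes a :: "'g::{topological_ab_group_add, t2_space}"
  assumes "compact (UNIV :: 'g set)" "infinite (UNIV :: 'g set)"
  shows "\<not> open {a}"
proof
  assume a: "open {a}"
  have "open {b}" for b :: 'g
  proof -
    have "open ((\<lambda>x. x + (a - b)) -` {a})"
      by (intro open_vimage a continuous_intros)
    moreover have "(\<lambda>x. x + (a - b)) -` {a} = {b}"
      by (auto simp: algebra_simps)
    ultimately show ?thesis by simp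
  qed
  then obtain D where "finite D" "(UNIV :: 'g set) \<subseteq> (\<Union>b\<in>D. {b})"
    using compactE_image[OF assms(1), of UNIV "\<lambda>b. {b}"] by auto
  then show False
    using assms(2) finite_subset[of UNIV D] by auto
qed

section \<open>Transfer of richness from integrable to continuous functions\<close>

theorem corollary4p15:
  fixes m :: "'g::{topological_ab_group_add, t2_space} measure"
    and \<Lambda> :: "('g \<Rightarrow> complex) set"
  assumes "compact (UNIV :: 'g set)"
    and "infinite (UNIV :: 'g set)"
    and "normalized_haar_measure m"
    and "\<Lambda> \<subseteq> dual_group"
    and "rich (L1_space m) (L1_spectral m \<Lambda>)"
  shows "rich (C_space :: ('g \<Rightarrow>\<^sub>C complex) normed_module) (C_spectral m \<Lambda>)"
proof -
  interpret compact_haar m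
    using assms(1,3) by (auto simp: compact_haar_def compact_haar_axioms_def normalized_haar_measure_def)
  \<comment> \<open>The peaks come from \<open>spectral_peak\<close>, whose hypothesis is supplied
    by \<open>rich_L1_spectral_imp\<close> for open sets, these having positive measure when
    nonempty.\<close>
  interpret peak_subspace "C_spectral m \<Lambda>"
  proof
    show "\<not> open {a}" for a :: 'g
      by (rule infinite_compact_group_perfect[OF assms(1,2)])
    show "bcontfun_scale c g \<in> C_spectral m \<Lambda>" if "g \<in> C_spectral m \<Lambda>" for c g
      using that by (auto simp: C_spectral_def fourier_def mult.assoc)
    fix U :: "'g set" and t and e :: real
    assume U: "open U" "t \<in> U" and e: "0 < e"
    have narrow: "\<exists>z w. integrable m z \<and> integrable m w \<and> (\<forall>\<gamma>\<in>dual_group - \<Lambda>. fourier m w \<gamma> = 0) \<and>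
        (LINT x|m. cmod (z x)) = 1 \<and>
        (LINT x|m. cmod (of_real (indicator W x / measure m W) - z x - w x)) \<le> d \<and>
        cmod (LINT x|m. (of_real (indicator W x / measure m W) - z x) * indicator W x) \<le> d \<and>
        2 - d \<le> (LINT x|m. cmod (z x - of_real (indicator W x / measure m W)))"
      if W: "open W" "W \<noteq> {}" and d: "0 < d" for W d
    proof -
      have "W \<in> sets m" "0 < measure m W"
        using W open_measure_pos by (auto simp: sets_m)
      then obtain z w where "integrable m z" "integrable m w"
        "\<And>\<gamma>. \<gamma> \<in> dual_group - \<Lambda> \<Longrightarrow> fourier m w \<gamma> = 0" "(LINT x|m. cmod (z x)) = 1"
        "(LINT x|m. cmod (of_real (indicator W x / measure m W) - z x - w x)) \<le> d"
        "cmod (LINT x|m. (of_real (indicator W x / measure m W) - z x) * indicator W x) \<le> d"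
        "2 - d \<le> (LINT x|m. cmod (z x - of_real (indicator W x / measure m W)))"
        by (rule rich_L1_spectral_imp[OF assms(5) finite_measure_axioms _ _ d]) (rule that)
      then show ?thesis
        by (intro exI[of _ z] exI[of _ w] conjI ballI)
    qed
    obtain q and g where q: "continuous_on UNIV q" "\<And>x. 0 \<le> q x" "\<And>x. q x \<le> 1"
      "\<And>x. x \<notin> U \<Longrightarrow> q x = 0" "1 - e \<le> q t"
      and g: "continuous_on UNIV g" "\<And>\<gamma>. \<gamma> \<in> dual_group - \<Lambda> \<Longrightarrow> fourier m g \<gamma> = 0"
      "\<And>x. cmod (of_real (q x) - g x) \<le> e"
      by (rule spectral_peak[OF narrow U e]) (assumption | rule that)+
    obtain C where "\<And>x. norm (g x) \<le> C"
      using continuous_bounded[OF g(1)] by metis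
    then have G: "apply_bcontfun (Bcontfun g) = g"
      using g(1) by (intro Bcontfun_inverse bcontfun_normI)
    have "Bcontfun g \<in> C_spectral m \<Lambda>"
      using g(2) by (auto simp: C_spectral_def G)
    then show "\<exists>q :: 'g \<Rightarrow> real. continuous_on UNIV q \<and> (\<forall>x. 0 \<le> q x \<and> q x \<le> 1) \<and>
        (\<forall>x. x \<notin> U \<longrightarrow> q x = 0) \<and> 1 - e \<le> q t \<and>
        (\<exists>g\<in>C_spectral m \<Lambda>. \<forall>x. cmod (of_real (q x) - apply_bcontfun g x) \<le> e)"
      using q g(3) by (intro exI[of _ q] conjI bexI[of _ "Bcontfun g"]) (simp_all add: G)
  qed
  show ?thesis
    by (rule rich_C_space[OF closed_subspace_C_spectral])
qed

end
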